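(* Let $1\le p\le\infty$. For any $p$-multinormed space $X$ there exists an index set $I$ so that $X$ is $p$-multiisometric to a subspace of a quotient of the Banach lattice $\ell^\infty(I,\ell^1)$, where $\ell^\infty(I,\ell^1)$ is equipped with its natural $p$-multinorm.
   Context: All spaces are over the real field; $\mathbb{N}=\{1,2,\dots\}$. For $1\le p\le\infty$, a $p$-multinormed space is a Banach space $X$ together with, for each $n\in\mathbb{N}$, a norm $\|\cdot\|_n$ (written $\|\cdot\|$) on $\ell^p_n\otimes X$ such that: (1) $\|a\otimes x\|_n=\|a\|\,\|x\|$ for $a\in\ell^p_n$, $x\in X$; (2) $\|w\|_n\ge|\langle a^*\otimes x^*,w\rangle|$ for all $w\in\ell^p_n\otimes X$ and all $a^*\in(\ell^p_n)^*$, $x^*\in X^*$ of norm at most $1$; (3) $\|(T\otimes I_X)w\|_m\le\|T\|\,\|w\|_n$ for all $m,n$, all $T\in B(\ell^p_n,\ell^p_m)$ and all $w\in\ell^p_n\otimes X$. (This is equivalent to giving a left tensorial cross-norm on $\ell^p\otimes X$, or on $c_0\otimes X$ if $p=\infty$.) Two $p$-multinormed spaces $X,Y$ are $p$-multiisometric if there is a linear bijection $u:X\to Y$ such that $I_{\ell^p_n}\otimes u:\ell^p_n\otimes X\to\ell^p_n\otimes Y$ is isometric for every $n$. A subspace of a $p$-multinormed space is a closed linear subspace $Y\subset X$, where $\ell^p_n\otimes Y$ carries the norm inherited from $\ell^p_n\otimes X$; the quotient $X/Y$ is the $p$-multinormed space in which $\ell^p_n\otimes(X/Y)=(\ell^p_n\otimes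 X)/(\ell^p_n\otimes Y)$ carries the quotient norm. The natural $p$-multinorm of a Banach lattice $E$ is given by $\big\|\sum_i\delta_i\otimes x_i\big\|_{\ell^p_n\otimes E}=\big\|\big(\sum_i|x_i|^p\big)^{1/p}\big\|_E$ (for $p=\infty$: $\big\|\bigvee_i|x_i|\big\|_E$), where $(\delta_i)$ is the canonical basis of $\ell^p_n$ and $x_1,\dots,x_n\in E$ (the right side is understood via the Krivine functional calculus). $\ell^\infty(I,\ell^1)$ is the Banach lattice of bounded families $(x_i)_{i\in I}$ in $\ell^1$ with the supremum norm and coordinatewise order. *)

theory Defs
  imports "HOL-Analysis.Analysis"
begin

section \<open>The spaces \<open>\<ell>\<^sup>p\<^sub>n\<close> and \<open>p\<close>-multinormed Banach spaces\<close>

text \<open>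
  Vectors of \<open>\<real>\<^sup>n\<close> are functions on \<^typ>\<open>nat\<close> that vanish from \<open>n\<close> on (the basis vectors are
  indexed by \<open>{..<n}\<close>). The tensor \<open>\<Sum>i<n. \<delta>\<^sub>i \<otimes> x\<^sub>i\<close> of \<open>\<ell>\<^sup>p\<^sub>n \<otimes> X\<close> is likewise the function \<open>i \<mapsto> x\<^sub>i\<close>,
  with \<open>x\<^sub>i = 0\<close> for \<open>i \<ge> n\<close>; every tensor has exactly one representation of this form.
\<close>

definition supported_below :: "nat \<Rightarrow> (nat \<Rightarrow> 'a::zero) set" where
  "supported_below n = {w. \<forall>i\<ge>n. w i = 0}"

text \<open>This only looks at the coordinates below \<open>n\<close>. The exponent \<open>p\<close> ranges over \<open>[1, \<infinity>]\<close>.\<close>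

definition lp_norm :: "ennreal \<Rightarrow> nat \<Rightarrow> (nat \<Rightarrow> real) \<Rightarrow> real" where
  "lp_norm p n a =
    (if p = \<infinity> then Max ((\<lambda>i. \<bar>a i\<bar>) ` {..<n})
     else (\<Sum>i<n. \<bar>a i\<bar> powr enn2real p) powr (1 / enn2real p))"

definition mat_apply :: "nat \<Rightarrow> nat \<Rightarrow> (nat \<Rightarrow> nat \<Rightarrow> real) \<Rightarrow> (nat \<Rightarrow> 'a::real_vector) \<Rightarrow> nat \<Rightarrow> 'a" where
  "mat_apply n m T w = (\<lambda>i. if i < m then \<Sum>j<n. T i j *\<^sub>R w j else 0)"

text \<open>
  An operator \<open>T : \<ell>\<^sup>p\<^sub>n \<rightarrow> \<ell>\<^sup>p\<^sub>m\<close> is given by its matrix; \<^const>\<open>mat_apply\<close> is \<open>T\<close> on scalar sequences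
  and \<open>T \<otimes> I\<^sub>X\<close> on \<open>X\<close>-valued ones.
\<close>

definition lp_opnorm :: "ennreal \<Rightarrow> nat \<Rightarrow> nat \<Rightarrow> (nat \<Rightarrow> nat \<Rightarrow> real) \<Rightarrow> real" where
  "lp_opnorm p n m T =
    (SUP a \<in> {a \<in> supported_below n. lp_norm p n a \<le> 1}. lp_norm p m (mat_apply n m T a))"

text \<open>
  A functional on \<open>\<ell>\<^sup>p\<^sub>n\<close> is given by its coefficients \<open>b\<close>, so that \<open>b \<otimes> f\<close> acts on \<open>\<ell>\<^sup>p\<^sub>n \<otimes> X\<close> by
  \<open>w \<mapsto> \<Sum>i<n. b\<^sub>i f(w\<^sub>i)\<close>.
\<close>

definition lp_dual_ball :: "ennreal \<Rightarrow> nat \<Rightarrow> (nat \<Rightarrow> real) set" where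
  "lp_dual_ball p n =
    {b \<in> supported_below n. \<forall>a \<in> supported_below n. \<bar>\<Sum>i<n. b i * a i\<bar> \<le> lp_norm p n a}"

locale p_multinormed =
  fixes p :: ennreal
    and N :: "nat \<Rightarrow> (nat \<Rightarrow> 'a::banach) \<Rightarrow> real"
  assumes nonneg: "n \<ge> 1 \<Longrightarrow> w \<in> supported_below n \<Longrightarrow> 0 \<le> N n w"
    and eq_zero: "n \<ge> 1 \<Longrightarrow> w \<in> supported_below n \<Longrightarrow> N n w = 0 \<longleftrightarrow> w = (\<lambda>_. 0)"
    and triangle: "n \<ge> 1 \<Longrightarrow> v \<in> supported_below n \<Longrightarrow> w \<in> supported_below n \<Longrightarrow>
      N n (\<lambda>i. v i + w i) \<le> N n v + N n w"
    and homogeneous: "n \<ge> 1 \<Longrightarrow> w \<in> supported_below n \<Longrightarrow> N n (\<lambda>i. c *\<^sub>R w i) = \<bar>c\<bar> * N n w"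
    and elementary: "n \<ge> 1 \<Longrightarrow> a \<in> supported_below n \<Longrightarrow>
      N n (\<lambda>i. a i *\<^sub>R x) = lp_norm p n a * norm x"
    and dual_bound: "n \<ge> 1 \<Longrightarrow> w \<in> supported_below n \<Longrightarrow> b \<in> lp_dual_ball p n \<Longrightarrow>
      bounded_linear f \<Longrightarrow> onorm f \<le> 1 \<Longrightarrow> \<bar>\<Sum>i<n. b i * f (w i)\<bar> \<le> N n w"
    and operator_bound: "n \<ge> 1 \<Longrightarrow> m \<ge> 1 \<Longrightarrow> w \<in> supported_below n \<Longrightarrow>
      N m (mat_apply n m T w) \<le> lp_opnorm p n m T * N n w"

section \<open>Subspaces, quotients and multiisometries\<close>

text \<open>
  Quotients by an arbitrary closed subspace are not types, so the operations on multinormed spaces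
  are defined for structures with an explicit carrier.
\<close>

record 'v normed_structure =
  vcarrier :: "'v set"
  vzero :: 'v
  vadd :: "'v \<Rightarrow> 'v \<Rightarrow> 'v"
  vscale :: "real \<Rightarrow> 'v \<Rightarrow> 'v"
  vnorm :: "'v \<Rightarrow> real"

record 'v multinormed_structure = "'v normed_structure" +
  mnorm :: "nat \<Rightarrow> (nat \<Rightarrow> 'v) \<Rightarrow> real"

definition multinormed_space ::
    "(nat \<Rightarrow> (nat \<Rightarrow> 'a::banach) \<Rightarrow> real) \<Rightarrow> 'a multinormed_structure" where
  "multinormed_space N =
    \<lparr>vcarrier = UNIV, vzero = 0, vadd = (+), vscale = (*\<^sub>R), vnorm = norm, mnorm = N\<rparr>"

definition tensors :: "nat \<Rightarrow> ('v, 'm) normed_structure_scheme \<Rightarrow> (nat \<Rightarrow> 'v) set" where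
  "tensors n V = {w. (\<forall>i<n. w i \<in> vcarrier V) \<and> (\<forall>i\<ge>n. w i = vzero V)}"

definition closed_subspace :: "('v, 'm) normed_structure_scheme \<Rightarrow> 'v set \<Rightarrow> bool" where
  "closed_subspace V Y \<longleftrightarrow>
    Y \<subseteq> vcarrier V \<and> vzero V \<in> Y \<and>
    (\<forall>x\<in>Y. \<forall>y\<in>Y. vadd V x y \<in> Y) \<and>
    (\<forall>c. \<forall>x\<in>Y. vscale V c x \<in> Y) \<and>
    (\<forall>s. \<forall>x\<in>vcarrier V. (\<forall>k. s k \<in> Y) \<and>
      (\<lambda>k. vnorm V (vadd V (s k) (vscale V (-1) x))) \<longlonglongrightarrow> 0 \<longrightarrow> x \<in> Y)"

definition subspace_of :: "'v multinormed_structure \<Rightarrow> 'v set \<Rightarrow> 'v multinormed_structure" where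
  "subspace_of V Y = V\<lparr>vcarrier := Y\<rparr>"

text \<open>
  The elements of the quotient are the cosets \<open>x + Z\<close>. A tensor over the quotient is a family of
  cosets; the tensors \<open>w\<close> over \<open>V\<close> in its class modulo \<open>\<ell>\<^sup>p\<^sub>n \<otimes> Z\<close> are those with \<open>w\<^sub>i\<close> in the \<open>i\<close>-th coset.
  Scaling adds \<open>Z\<close> because \<open>0 \<cdot> (x + Z)\<close> as a set of multiples is only \<open>{0}\<close>.
\<close>

definition quotient_by :: "'v multinormed_structure \<Rightarrow> 'v set \<Rightarrow> 'v set multinormed_structure" where
  "quotient_by V Z =
    \<lparr>vcarrier = (\<lambda>x. vadd V x ` Z) ` vcarrier V,
     vzero = Z,
     vadd = (\<lambda>A B. {vadd V a b | a b. a \<in> A \<and> b \<in> B}),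
     vscale = (\<lambda>c A. {vadd V (vscale V c a) z | a z. a \<in> A \<and> z \<in> Z}),
     vnorm = (\<lambda>A. INF a\<in>A. vnorm V a),
     mnorm = (\<lambda>n W. INF w\<in>{w \<in> tensors n V. \<forall>i<n. w i \<in> W i}. mnorm V n w)\<rparr>"

definition multiisometric :: "'v multinormed_structure \<Rightarrow> 'w multinormed_structure \<Rightarrow> bool" where
  "multiisometric V W \<longleftrightarrow>
    (\<exists>u. bij_betw u (vcarrier V) (vcarrier W) \<and>
      (\<forall>x\<in>vcarrier V. \<forall>y\<in>vcarrier V. u (vadd V x y) = vadd W (u x) (u y)) \<and>
      (\<forall>c. \<forall>x\<in>vcarrier V. u (vscale V c x) = vscale W c (u x)) \<and>
      (\<forall>n\<ge>1. \<forall>w\<in>tensors n V. mnorm W n (u \<circ> w) = mnorm V n w))"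

section \<open>The natural multinorm of a Banach lattice\<close>

record 'v normed_lattice_structure = "'v normed_structure" +
  vle :: "'v \<Rightarrow> 'v \<Rightarrow> bool"

definition is_join :: "'v normed_lattice_structure \<Rightarrow> 'v \<Rightarrow> 'v \<Rightarrow> 'v \<Rightarrow> bool" where
  "is_join E x y z \<longleftrightarrow> z \<in> vcarrier E \<and> vle E x z \<and> vle E y z \<and>
    (\<forall>b\<in>vcarrier E. vle E x b \<and> vle E y b \<longrightarrow> vle E z b)"

text \<open>
  The continuous positively homogeneous functions on \<open>\<real>\<^sup>n\<close>, extended to all sequences by ignoring
  the coordinates from \<open>n\<close> on; for such functions continuity in the product topology is continuity
  on \<open>\<real>\<^sup>n\<close>.
\<close>

definition krivine_functions :: "nat \<Rightarrow> ((nat \<Rightarrow> real) \<Rightarrow> real) set" where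
  "krivine_functions n =
    {h. continuous_on UNIV h \<and>
        (\<forall>a b. (\<forall>i<n. a i = b i) \<longrightarrow> h a = h b) \<and>
        (\<forall>c\<ge>0. \<forall>a. h (\<lambda>i. c * a i) = c * h a)}"

text \<open>
  The Krivine functional calculus at \<open>x\<^sub>0, \<dots>, x\<^bsub>n-1\<^esub>\<close> is the unique lattice homomorphism
  \<open>\<Phi>\<close> from the above functions to \<open>E\<close> that maps the \<open>i\<close>-th coordinate function to \<open>x\<^sub>i\<close>.
\<close>

definition krivine_hom ::
    "'v normed_lattice_structure \<Rightarrow> nat \<Rightarrow> (nat \<Rightarrow> 'v) \<Rightarrow> (((nat \<Rightarrow> real) \<Rightarrow> real) \<Rightarrow> 'v) \<Rightarrow> bool" where
  "krivine_hom E n x \<Phi> \<longleftrightarrow>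
    (\<forall>h\<in>krivine_functions n. \<Phi> h \<in> vcarrier E) \<and>
    (\<forall>g\<in>krivine_functions n. \<forall>h\<in>krivine_functions n. \<Phi> (\<lambda>a. g a + h a) = vadd E (\<Phi> g) (\<Phi> h)) \<and>
    (\<forall>c. \<forall>h\<in>krivine_functions n. \<Phi> (\<lambda>a. c * h a) = vscale E c (\<Phi> h)) \<and>
    (\<forall>g\<in>krivine_functions n. \<forall>h\<in>krivine_functions n.
      is_join E (\<Phi> g) (\<Phi> h) (\<Phi> (\<lambda>a. max (g a) (h a)))) \<and>
    (\<forall>i<n. \<Phi> (\<lambda>a. a i) = x i)"

definition krivine ::
    "'v normed_lattice_structure \<Rightarrow> nat \<Rightarrow> (nat \<Rightarrow> 'v) \<Rightarrow> ((nat \<Rightarrow> real) \<Rightarrow> real) \<Rightarrow> 'v" where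
  "krivine E n x h = (THE y. \<exists>\<Phi>. krivine_hom E n x \<Phi> \<and> \<Phi> h = y)"

text \<open>
  Applying the calculus to \<^term>\<open>lp_norm p n\<close> yields \<open>(\<Sum>i<n. \<bar>x\<^sub>i\<bar>\<^sup>p)\<^sup>1\<^sup>/\<^sup>p\<close>, and \<open>\<bar>x\<^sub>0\<bar> \<squnion> \<dots> \<squnion> \<bar>x\<^bsub>n-1\<^esub>\<bar>\<close> if \<open>p = \<infinity>\<close>.
\<close>

definition natural_multinorm ::
    "ennreal \<Rightarrow> 'v normed_lattice_structure \<Rightarrow> 'v multinormed_structure" where
  "natural_multinorm p E =
    \<lparr>vcarrier = vcarrier E, vzero = vzero E, vadd = vadd E, vscale = vscale E, vnorm = vnorm E,
     mnorm = (\<lambda>n x. vnorm E (krivine E n x (lp_norm p n)))\<rparr>"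

section \<open>The Banach lattice \<open>\<ell>\<^sup>\<infinity>(I, \<ell>\<^sup>1)\<close>\<close>

text \<open>
  Families indexed by \<open>I\<close> are extended by \<open>0\<close> outside \<open>I\<close>. Inserting \<open>0\<close> matters only for \<open>I = {}\<close>,
  where the real supremum would be unspecified.
\<close>

definition linf_l1 :: "'i set \<Rightarrow> ('i \<Rightarrow> nat \<Rightarrow> real) normed_lattice_structure" where
  "linf_l1 I =
    \<lparr>vcarrier = {x. (\<forall>i. i \<notin> I \<longrightarrow> x i = (\<lambda>_. 0)) \<and>
                    (\<forall>i\<in>I. summable (\<lambda>k. \<bar>x i k\<bar>)) \<and>
                    bdd_above ((\<lambda>i. \<Sum>k. \<bar>x i k\<bar>) ` I)},
     vzero = (\<lambda>_ _. 0),
     vadd = (\<lambda>x y i k. x i k + y i k),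
     vscale = (\<lambda>c x i k. c * x i k),
     vnorm = (\<lambda>x. Sup (insert 0 ((\<lambda>i. \<Sum>k. \<bar>x i k\<bar>) ` I))),
     vle = (\<lambda>x y. \<forall>i\<in>I. \<forall>k. x i k \<le> y i k)\<rparr>"

end

theory Submission
  imports Defs "HOL-Library.Function_Algebras"
begin

text \<open>
  A tensor \<open>w \<in> \<ell>\<^sup>p\<^sub>n \<otimes> X\<close> is an operator \<open>(\<ell>\<^sup>p\<^sub>n)\<^sup>* \<rightarrow> X\<close>, and condition (3) says that it has multinorm at most
  \<open>\<parallel>w\<parallel>\<close> if \<open>\<ell>\<^sup>p\<^sub>m \<otimes> (\<ell>\<^sup>p\<^sub>n)\<^sup>*\<close> carries the operator norm of \<open>B(\<ell>\<^sup>p\<^sub>n, \<ell>\<^sup>p\<^sub>m)\<close>. This is the norm that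
  \<open>(\<ell>\<^sup>p\<^sub>n)\<^sup>*\<close> inherits from the bounded functions on the unit ball \<open>S\<^sub>w\<close> of \<open>\<ell>\<^sup>p\<^sub>n\<close>. Hence \<open>X\<close> is a quotient of a
  subspace of the \<open>\<ell>\<^sup>1\<close>-sum over all \<open>w\<close> of the lattices \<open>\<ell>\<^sup>\<infinity>(S\<^sub>w)\<close>, each scaled by \<open>\<parallel>w\<parallel>\<close>. That sum embeds in
  some \<open>\<ell>\<^sup>\<infinity>(I, \<ell>\<^sup>1)\<close>, where an index consists of a sequence of tensors \<open>w\<close> and a point of \<open>S\<^sub>w\<close> for each of them.
  It suffices to use finite sums, and to divide by the closure of the kernel of the map to \<open>X\<close>.
\<close>

section \<open>The norm of \<open>\<ell>\<^sup>p\<^sub>n\<close>\<close>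

lemma lp_norm_cong: "(\<And>i. i < n \<Longrightarrow> a i = b i) \<Longrightarrow> lp_norm p n a = lp_norm p n b"
  unfolding lp_norm_def by (auto intro!: arg_cong[where f=Max] arg_cong2[where f="(powr)"] sum.cong image_cong)

lemma lp_norm_top_le_iff:
  assumes "n \<ge> 1"
  shows "lp_norm top n a \<le> c \<longleftrightarrow> (\<forall>i<n. \<bar>a i\<bar> \<le> c)"
proof -
  have "{..<n} \<noteq> {}" using assms by (simp add: lessThan_empty_iff)
  then show ?thesis unfolding lp_norm_def by (auto simp: Max_le_iff)
qed

lemma abs_le_lp_norm_top: "i < n \<Longrightarrow> \<bar>a i\<bar> \<le> lp_norm top n a"
  unfolding lp_norm_def by (auto intro!: Max_ge)

lemma enn2real_ge_1:
  assumes "1 \<le> p" "p \<noteq> (\<infinity>::ennreal)"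
  shows "1 \<le> enn2real p"
  using assms by (cases p) (auto simp: ennreal_ge_1)

lemma lp_norm_nonneg: "n \<ge> 1 \<Longrightarrow> 0 \<le> lp_norm p n a"
proof (cases "p = \<infinity>")
  case True
  assume "n \<ge> 1"
  then have "\<bar>a 0\<bar> \<le> lp_norm top n a" by (intro abs_le_lp_norm_top) simp
  then show ?thesis using True by simp
qed (simp add: lp_norm_def)

lemma lp_norm_powr:
  assumes "1 \<le> p" "p \<noteq> \<infinity>"
  shows "lp_norm p n a powr enn2real p = (\<Sum>i<n. \<bar>a i\<bar> powr enn2real p)"
  using enn2real_ge_1[OF assms] assms by (simp add: lp_norm_def powr_powr sum_nonneg)

lemma abs_le_lp_norm:
  assumes "1 \<le> p" "i < n"
  shows "\<bar>a i\<bar> \<le> lp_norm p n a"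
proof (cases "p = \<infinity>")
  case False
  note P = enn2real_ge_1[OF assms(1) False]
  have "\<bar>a i\<bar> powr enn2real p \<le> (\<Sum>i<n. \<bar>a i\<bar> powr enn2real p)"
    using assms by (intro member_le_sum) auto
  then have "(\<bar>a i\<bar> powr enn2real p) powr (1 / enn2real p) \<le> lp_norm p n a"
    using False P by (auto simp: lp_norm_def intro!: powr_mono2)
  then show ?thesis using P by (simp add: powr_powr)
qed (use assms abs_le_lp_norm_top in auto)

lemma lp_norm_scale:
  assumes "1 \<le> p" "n \<ge> 1"
  shows "lp_norm p n (\<lambda>i. c * a i) = \<bar>c\<bar> * lp_norm p n a"
proof (cases "p = \<infinity>")
  case True
  have *: "Max ((\<lambda>i. \<bar>c * a i\<bar>) ` {..<n}) = \<bar>c\<bar> * Max ((\<lambda>i. \<bar>a i\<bar>) ` {..<n})"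
  proof -
    have "mono (\<lambda>x::real. \<bar>c\<bar> * x)" by (auto intro!: monoI mult_left_mono)
    from mono_Max_commute[OF this, of "(\<lambda>i. \<bar>a i\<bar>) ` {..<n}"] show ?thesis
      using assms by (auto simp: image_image abs_mult lessThan_empty_iff)
  qed
  then show ?thesis using True by (simp add: lp_norm_def)
next
  case False
  note P = enn2real_ge_1[OF assms(1) False]
  have "(\<Sum>i<n. \<bar>c * a i\<bar> powr enn2real p) = \<bar>c\<bar> powr enn2real p * (\<Sum>i<n. \<bar>a i\<bar> powr enn2real p)"
    by (simp add: abs_mult powr_mult sum_distrib_left)
  then show ?thesis using False P
    by (simp add: lp_norm_def powr_mult sum_nonneg powr_powr)
qed

lemma lp_norm_zero: "n \<ge> 1 \<Longrightarrow> lp_norm p n (\<lambda>_. 0) = 0"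
  by (cases n) (auto simp: lp_norm_def lessThan_Suc_eq_insert_0 image_image image_constant_conv)

text \<open>Each term \<open>x powr P\<close> with \<open>x \<le> S\<close> is at most
  \<open>x * S powr (P - 1)\<close>, and these bounds add up to \<open>S powr P\<close>.\<close>

lemma lp_norm_le_sum:
  assumes "1 \<le> p" "n \<ge> 1"
  shows "lp_norm p n a \<le> (\<Sum>i<n. \<bar>a i\<bar>)"
proof (cases "p = \<infinity>")
  case True
  then show ?thesis using assms
    by (auto simp: lp_norm_top_le_iff intro!: member_le_sum[where f="\<lambda>i. \<bar>a i\<bar>"])
next
  case False
  define P where "P = enn2real p"
  have P: "P \<ge> 1" using enn2real_ge_1[OF assms(1) False] by (simp add: P_def)
  define S where "S = (\<Sum>i<n. \<bar>a i\<bar>)"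
  have S: "S \<ge> 0" by (simp add: S_def sum_nonneg)
  have *: "x powr P = x * x powr (P - 1)" if "x \<ge> 0" for x :: real
    using that by (cases "x = 0") (auto simp: powr_diff)
  have "(\<Sum>i<n. \<bar>a i\<bar> powr P) \<le> (\<Sum>i<n. \<bar>a i\<bar> * S powr (P - 1))"
  proof (rule sum_mono)
    fix i assume "i \<in> {..<n}"
    then have "\<bar>a i\<bar> \<le> S" unfolding S_def by (intro member_le_sum) auto
    then show "\<bar>a i\<bar> powr P \<le> \<bar>a i\<bar> * S powr (P - 1)"
      using P by (subst *) (auto intro!: mult_left_mono powr_mono2)
  qed
  also have "\<dots> = S powr P" using *[OF S] by (simp add: S_def sum_distrib_right)
  finally have "(\<Sum>i<n. \<bar>a i\<bar> powr P) powr (1 / P) \<le> (S powr P) powr (1 / P)"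
    using P by (intro powr_mono2) (auto intro: sum_nonneg)
  then show ?thesis using P S False by (simp add: powr_powr lp_norm_def P_def S_def)
qed

lemma lp_norm_1: "1 \<le> p \<Longrightarrow> lp_norm p 1 a = \<bar>a 0\<bar>"
  using abs_le_lp_norm[of p 0 1 a] lp_norm_le_sum[of p 1 a] by simp

lemma lp_norm_eq_0D: "1 \<le> p \<Longrightarrow> lp_norm p n a = 0 \<Longrightarrow> i < n \<Longrightarrow> a i = 0"
  using abs_le_lp_norm[of p i n a] by simp

text \<open>The second derivative test only covers positive arguments. If one endpoint is
  \<open>0\<close>, convexity reduces to \<open>s powr q \<le> s\<close> for
  \<open>0 < s < 1\<close>.\<close>

lemma convex_on_powr_nonneg:
  assumes "q \<ge> 1"
  shows "convex_on {0..} (\<lambda>x::real. x powr q)"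
proof (intro convex_onI)
  fix t x y :: real
  assume t: "0 < t" "t < 1" and xy: "x \<in> {0..}" "y \<in> {0..}"
  have conv: "convex_on {0<..} (\<lambda>x::real. x powr q)"
    by (rule f''_ge0_imp_convex[where f' = "\<lambda>x. q * x powr (q - 1)" and f'' = "\<lambda>x. q * ((q - 1) * x powr (q - 2))"])
      (use assms in \<open>auto intro!: derivative_eq_intros has_real_derivative_powr\<close>)
  have sub: "s powr q \<le> s" if "0 < s" "s < 1" for s :: real
    using powr_mono'[of 1 q s] that assms by simp
  consider "x = 0" | "y = 0" "x > 0" | "x > 0" "y > 0" using xy by force
  then show "((1 - t) *\<^sub>R x + t *\<^sub>R y) powr q \<le> (1 - t) * x powr q + t * y powr q"
  proof cases
    case 1
    then show ?thesis using t xy sub[of t] by (auto simp: powr_mult intro!: mult_right_mono)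
  next
    case 2
    then show ?thesis using t xy sub[of "1 - t"] by (auto simp: powr_mult intro!: mult_right_mono)
  next
    case 3
    then show ?thesis using convex_onD[OF conv, of t x y] t by auto
  qed
qed (rule convex_real_interval)

text \<open>Minkowski's inequality: after division by the sum of the norms, this is convexity of \<open>x\<^sup>p\<close>.\<close>

lemma lp_norm_triangle:
  assumes "1 \<le> p" "n \<ge> 1"
  shows "lp_norm p n (\<lambda>i. a i + b i) \<le> lp_norm p n a + lp_norm p n b"
proof (cases "p = \<infinity>")
  case True
  have "\<bar>a i + b i\<bar> \<le> lp_norm top n a + lp_norm top n b" if "i < n" for i
    using abs_le_lp_norm_top[OF that, of a] abs_le_lp_norm_top[OF that, of b] by linarith
  then show ?thesis using assms True by (simp add: lp_norm_top_le_iff)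
next
  case False
  define P where "P = enn2real p"
  have P: "P \<ge> 1" using enn2real_ge_1[OF assms(1) False] by (simp add: P_def)
  define A B where "A = lp_norm p n a" and "B = lp_norm p n b"
  have AB: "A \<ge> 0" "B \<ge> 0" using assms by (auto simp: A_def B_def lp_norm_nonneg)
  consider "A = 0" | "B = 0" | "A > 0" "B > 0" using AB by linarith
  then show ?thesis
  proof cases
    case 1
    then have "lp_norm p n (\<lambda>i. a i + b i) = B"
      using lp_norm_eq_0D[OF assms(1)] unfolding A_def B_def by (intro lp_norm_cong) auto
    then show ?thesis using 1 AB by (simp add: A_def B_def)
  next
    case 2
    then have "lp_norm p n (\<lambda>i. a i + b i) = A"
      using lp_norm_eq_0D[OF assms(1)] unfolding A_def B_def by (intro lp_norm_cong) auto
    then show ?thesis using 2 AB by (simp add: A_def B_def)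
  next
    case 3
    \<comment> \<open>Weights proportional to the two norms: the bound below, summed over
      \<open>i\<close>, collapses to \<open>(A + B) powr P * ((1 - t) + t)\<close>.\<close>
    define t where "t = B / (A + B)"
    have t: "0 \<le> t" "t \<le> 1" and t': "1 - t = A / (A + B)" using 3 by (auto simp: t_def field_simps)
    have "\<bar>a i + b i\<bar> powr P \<le> (A + B) powr P *
        ((1 - t) * (\<bar>a i\<bar> powr P / A powr P) + t * (\<bar>b i\<bar> powr P / B powr P))" for i
    proof -
      have "(1 - t) * (\<bar>a i\<bar> / A) = \<bar>a i\<bar> / (A + B)" "t * (\<bar>b i\<bar> / B) = \<bar>b i\<bar> / (A + B)"
        using 3 unfolding t' unfolding t_def by auto
      then have "\<bar>a i\<bar> + \<bar>b i\<bar> = (A + B) * ((1 - t) * (\<bar>a i\<bar> / A) + t * (\<bar>b i\<bar> / B))"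
        using 3 by (simp add: distrib_left)
      then have "\<bar>a i + b i\<bar> powr P \<le> ((A + B) * ((1 - t) * (\<bar>a i\<bar> / A) + t * (\<bar>b i\<bar> / B))) powr P"
        using P abs_triangle_ineq[of "a i" "b i"] by (intro powr_mono2) linarith+
      also have "\<dots> = (A + B) powr P * ((1 - t) * (\<bar>a i\<bar> / A) + t * (\<bar>b i\<bar> / B)) powr P"
        using 3 t by (intro powr_mult)
      also have "\<dots> \<le> (A + B) powr P *
          ((1 - t) * (\<bar>a i\<bar> / A) powr P + t * (\<bar>b i\<bar> / B) powr P)"
        using convex_onD[OF convex_on_powr_nonneg[OF P], of t "\<bar>a i\<bar> / A" "\<bar>b i\<bar> / B"] t 3
        by (intro mult_left_mono) auto
      finally show ?thesis using 3 by (simp add: powr_divide)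
    qed
    then have "(\<Sum>i<n. \<bar>a i + b i\<bar> powr P) \<le> (\<Sum>i<n. (A + B) powr P *
        ((1 - t) * (\<bar>a i\<bar> powr P / A powr P) + t * (\<bar>b i\<bar> powr P / B powr P)))"
      by (intro sum_mono)
    also have "\<dots> = (A + B) powr P * ((1 - t) * ((\<Sum>i<n. \<bar>a i\<bar> powr P) / A powr P)
        + t * ((\<Sum>i<n. \<bar>b i\<bar> powr P) / B powr P))"
      by (simp add: sum_distrib_left sum.distrib sum_divide_distrib distrib_left)
    also have "\<dots> = (A + B) powr P"
      using 3 unfolding A_def B_def P_def by (simp flip: lp_norm_powr[OF assms(1) False])
    finally have "(\<Sum>i<n. \<bar>a i + b i\<bar> powr P) powr (1 / P) \<le> ((A + B) powr P) powr (1 / P)"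
      using P by (intro powr_mono2) (auto intro: sum_nonneg)
    then show ?thesis using P 3 False by (simp add: powr_powr lp_norm_def P_def A_def B_def)
  qed
qed

text \<open>A Lipschitz form of the triangle inequality. It yields continuity and later absorbs the
  errors of approximate lifts.\<close>

lemma lp_norm_le_add_sum:
  assumes "1 \<le> p" "n \<ge> 1"
  shows "lp_norm p n a \<le> lp_norm p n b + (\<Sum>i<n. \<bar>a i - b i\<bar>)"
  using lp_norm_triangle[OF assms, of b "\<lambda>i. a i - b i"] lp_norm_le_sum[OF assms, of "\<lambda>i. a i - b i"]
  by simp

text \<open>Only finitely many coordinates enter the Lipschitz bound, so it tends to
  \<open>0\<close> in the product topology on all sequences.\<close>

lemma continuous_on_lp_norm:
  assumes "1 \<le> p" "n \<ge> 1"
  shows "continuous_on UNIV (lp_norm p n)"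
proof -
  have "(lp_norm p n \<longlongrightarrow> lp_norm p n a) (at a)" for a
  proof (rule Lim_null_comparison[THEN LIM_zero_cancel])
    show "\<forall>\<^sub>F b in at a. norm (lp_norm p n b - lp_norm p n a) \<le> (\<Sum>i<n. \<bar>b i - a i\<bar>)"
      using lp_norm_le_add_sum[OF assms, of a] lp_norm_le_add_sum[OF assms, of _ a]
      by (intro always_eventually) (auto simp: abs_le_iff abs_minus_commute diff_le_eq add.commute)
    have "continuous_on UNIV (\<lambda>b. \<Sum>i<n. \<bar>b i - a i\<bar>)"
      by (intro continuous_intros continuous_on_product_coordinates)
    then have "((\<lambda>b. \<Sum>i<n. \<bar>b i - a i\<bar>) \<longlongrightarrow> (\<Sum>i<n. \<bar>a i - a i\<bar>)) (at a)"
      unfolding continuous_on_def by blast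
    then show "((\<lambda>b. \<Sum>i<n. \<bar>b i - a i\<bar>) \<longlongrightarrow> 0) (at a)" by simp
  qed
  then show ?thesis by (simp add: continuous_on_def)
qed

lemma lp_norm_in_krivine_functions:
  assumes "1 \<le> p" "n \<ge> 1"
  shows "lp_norm p n \<in> krivine_functions n"
  unfolding krivine_functions_def using assms
  by (auto simp: continuous_on_lp_norm lp_norm_scale intro: lp_norm_cong)

section \<open>Lattice homomorphisms on positively homogeneous functions\<close>

lemma krivine_functions_coord: "i < n \<Longrightarrow> (\<lambda>a. a i) \<in> krivine_functions n"
  by (auto simp: krivine_functions_def)

lemma krivine_functions_add:
  "g \<in> krivine_functions n \<Longrightarrow> h \<in> krivine_functions n \<Longrightarrow> (\<lambda>a. g a + h a) \<in> krivine_functions n"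
  unfolding krivine_functions_def by (auto intro!: continuous_on_add simp: distrib_left) metis

lemma krivine_functions_scale:
  "h \<in> krivine_functions n \<Longrightarrow> (\<lambda>a. c * h a) \<in> krivine_functions n"
  unfolding krivine_functions_def by (auto intro!: continuous_on_mult_left)

lemma krivine_functions_max:
  "g \<in> krivine_functions n \<Longrightarrow> h \<in> krivine_functions n \<Longrightarrow> (\<lambda>a. max (g a) (h a)) \<in> krivine_functions n"
  unfolding krivine_functions_def by (auto intro!: continuous_on_max simp: max_mult_distrib_left) metis

lemma krivine_functions_abs:
  assumes "h \<in> krivine_functions n"
  shows "(\<lambda>a. \<bar>h a\<bar>) \<in> krivine_functions n"
proof -
  have "(\<lambda>a. \<bar>h a\<bar>) = (\<lambda>a. max (h a) ((-1) * h a))" by (auto simp: fun_eq_iff)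
  then show ?thesis using assms by (simp only: krivine_functions_max krivine_functions_scale)
qed

lemma krivine_functions_zero: "(\<lambda>_. 0) \<in> krivine_functions n"
  by (auto simp: krivine_functions_def)

lemma krivine_functions_sum:
  "(\<And>j. j \<in> A \<Longrightarrow> h j \<in> krivine_functions n) \<Longrightarrow> (\<lambda>a. \<Sum>j\<in>A. h j a) \<in> krivine_functions n"
  by (induction A rule: infinite_finite_induct)
    (auto intro: krivine_functions_zero krivine_functions_add)

lemma krivine_functions_cong:
  "h \<in> krivine_functions n \<Longrightarrow> (\<And>i. i < n \<Longrightarrow> a i = b i) \<Longrightarrow> h a = h b"
  unfolding krivine_functions_def by blast

lemma krivine_functions_homogeneous:
  "h \<in> krivine_functions n \<Longrightarrow> 0 \<le> c \<Longrightarrow> h (\<lambda>i. c * a i) = c * h a"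
  unfolding krivine_functions_def by blast

lemma krivine_functions_eq_0:
  "h \<in> krivine_functions n \<Longrightarrow> (\<And>i. i < n \<Longrightarrow> a i = 0) \<Longrightarrow> h a = 0"
  using krivine_functions_homogeneous[of h n 0 a] krivine_functions_cong[of h n a "\<lambda>i. 0 * a i"] by simp

text \<open>By Tychonoff the cube \<open>?K\<close> is compact, and the sphere is cut out of it by
  closed conditions on coordinates. Fixing the coordinates from \<open>n\<close> on is what keeps
  the sphere inside the cube.\<close>

lemma compact_l1_sphere: "compact {a \<in> supported_below n. (\<Sum>j<n. \<bar>a j\<bar>) = (1::real)}"
proof -
  let ?S = "{a \<in> supported_below n. (\<Sum>j<n. \<bar>a j\<bar>) = (1::real)}"
  let ?K = "PiE UNIV (\<lambda>_::nat. {-1..1::real})"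
  have "compactin (product_topology (\<lambda>_. euclidean) UNIV) ?K"
    unfolding compactin_PiE by (auto simp: compactin_euclidean_iff)
  then have K: "compact ?K" by (simp add: euclidean_product_topology compactin_euclidean_iff)
  have "?S = (\<Inter>i\<in>{n..}. {a. a i = 0}) \<inter> {a. (\<Sum>j<n. \<bar>a j\<bar>) = 1}"
    by (auto simp: supported_below_def)
  moreover have "closed \<dots>"
    by (intro closed_Int closed_INT ballI closed_Collect_eq continuous_intros continuous_on_product_coordinates)
  ultimately have "closed ?S" by simp
  with K have "compact (?K \<inter> ?S)" by (rule compact_Int_closed)
  moreover have "?S \<subseteq> ?K"
  proof
    fix a :: "nat \<Rightarrow> real" assume a: "a \<in> {a \<in> supported_below n. (\<Sum>j<n. \<bar>a j\<bar>) = 1}"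
    have "\<bar>a i\<bar> \<le> 1" for i
    proof (cases "i < n")
      case True
      then have "\<bar>a i\<bar> \<le> (\<Sum>j<n. \<bar>a j\<bar>)" by (intro member_le_sum[where f="\<lambda>j. \<bar>a j\<bar>"]) auto
      then show ?thesis using a by simp
    qed (use a in \<open>auto simp: supported_below_def\<close>)
    then show "a \<in> ?K" by (auto simp: abs_le_iff minus_le_iff)
  qed
  ultimately show ?thesis by (simp add: Int_absorb1)
qed

text \<open>Compactness of the sphere is the reason. Where \<open>d\<close> vanishes,
  \<open>g\<close> is below \<open>\<epsilon>\<close>; elsewhere a large multiple of
  \<open>d\<close> exceeds \<open>g\<close>. Finitely many of the open sets \<open>U k\<close>
  therefore cover the sphere, and homogeneity extends the bound to all vectors.\<close>

lemma krivine_functions_bound: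
  assumes g: "g \<in> krivine_functions n" and d: "d \<in> krivine_functions n"
    and d_nonneg: "\<And>a. 0 \<le> d a" and le: "\<And>a. d a = 0 \<Longrightarrow> g a \<le> 0" and eps: "\<epsilon> > 0"
  obtains C where "C \<ge> 0" "\<And>a. g a \<le> \<epsilon> * (\<Sum>j<n. \<bar>a j\<bar>) + C * d a"
proof -
  define S where "S = {a \<in> supported_below n. (\<Sum>j<n. \<bar>a j\<bar>) = (1::real)}"
  define U where "U k = {a. g a < \<epsilon> + real k * d a}" for k :: nat
  have cont: "continuous_on UNIV g" "continuous_on UNIV d"
    using g d by (auto simp: krivine_functions_def)
  have "S \<subseteq> (\<Union>k\<in>UNIV. U k)"
  proof
    fix a
    show "a \<in> (\<Union>k\<in>UNIV. U k)"
    proof (cases "d a = 0")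
      case True
      then show ?thesis using le[of a] eps by (auto simp: U_def)
    next
      case False
      then obtain k where "g a < real k * d a"
        using reals_Archimedean3[of "d a"] d_nonneg[of a] by (metis order_le_less)
      then show ?thesis using eps by (auto simp: U_def intro!: exI[of _ k])
    qed
  qed
  moreover have "open (U k)" for k
    unfolding U_def by (intro open_Collect_less continuous_intros cont)
  moreover have "compact S" unfolding S_def by (rule compact_l1_sphere)
  ultimately obtain D where D: "finite D" "S \<subseteq> (\<Union>k\<in>D. U k)"
    by (metis compactE_image)
  \<comment> \<open>The sum bounds every index in \<open>D\<close> and, unlike a maximum, makes
    sense for empty \<open>D\<close> as well.\<close>
  define C where "C = (\<Sum>k\<in>D. real k)"
  have C: "C \<ge> 0" by (simp add: C_def sum_nonneg)
  have S_bound: "g a \<le> \<epsilon> + C * d a" if a: "a \<in> S" for a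
  proof -
    obtain k where k: "k \<in> D" "g a < \<epsilon> + real k * d a" using D a by (auto simp: U_def)
    have "real k \<le> C" unfolding C_def using k D by (intro member_le_sum) auto
    then have "real k * d a \<le> C * d a" using d_nonneg by (intro mult_right_mono)
    then show ?thesis using k by linarith
  qed
  show thesis
  proof (rule that[OF C])
    fix a :: "nat \<Rightarrow> real"
    define \<sigma> where "\<sigma> = (\<Sum>j<n. \<bar>a j\<bar>)"
    show "g a \<le> \<epsilon> * (\<Sum>j<n. \<bar>a j\<bar>) + C * d a"
    proof (cases "\<sigma> = 0")
      case True
      then have "a j = 0" if "j < n" for j using that by (simp add: \<sigma>_def sum_nonneg_eq_0_iff)
      then have "g a = 0" "d a = 0" using krivine_functions_eq_0 g d by auto
      then show ?thesis using eps by (simp add: sum_nonneg)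
    next
      case False
      moreover have "\<sigma> \<ge> 0" by (simp add: \<sigma>_def sum_nonneg)
      ultimately have \<sigma>: "\<sigma> > 0" by simp
      \<comment> \<open>Cutting off at \<open>n\<close> puts \<open>b\<close> into \<open>S\<close>;
        functions of the class do not notice the change.\<close>
      define b where "b j = (if j < n then a j / \<sigma> else 0)" for j
      have "b \<in> S" using \<sigma> by (simp add: S_def supported_below_def b_def \<sigma>_def flip: sum_divide_distrib)
      then have "\<sigma> * g b \<le> \<sigma> * (\<epsilon> + C * d b)" using S_bound \<sigma> by (intro mult_left_mono) auto
      moreover have "h a = \<sigma> * h b" if h: "h \<in> krivine_functions n" for h
        using krivine_functions_cong[OF h, of a "\<lambda>i. \<sigma> * b i"] krivine_functions_homogeneous[OF h, of \<sigma> b] \<sigma>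
        by (simp add: b_def)
      ultimately show ?thesis using g d by (simp add: \<sigma>_def algebra_simps)
    qed
  qed
qed

text \<open>The preceding bound with the l1 norm as \<open>d\<close> and
  \<open>\<epsilon> = 1\<close>: where that norm is zero, so is \<open>h\<close>.\<close>

lemma krivine_functions_abs_bound:
  assumes h: "h \<in> krivine_functions n"
  obtains C where "C \<ge> 0" "\<And>a. \<bar>h a\<bar> \<le> C * (\<Sum>j<n. \<bar>a j\<bar>)"
proof -
  have nu: "(\<lambda>a. \<Sum>j<n. \<bar>a j\<bar>) \<in> krivine_functions n"
    by (intro krivine_functions_sum krivine_functions_abs krivine_functions_coord) auto
  have "\<bar>h a\<bar> \<le> 0" if "(\<Sum>j<n. \<bar>a j\<bar>) = 0" for a
    using that krivine_functions_eq_0[OF h, of a] by (simp add: sum_nonneg_eq_0_iff)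
  then obtain C where "C \<ge> 0" "\<And>a. \<bar>h a\<bar> \<le> 1 * (\<Sum>j<n. \<bar>a j\<bar>) + C * (\<Sum>j<n. \<bar>a j\<bar>)"
    using krivine_functions_bound[OF krivine_functions_abs[OF h] nu sum_nonneg _ zero_less_one] by (metis abs_ge_zero)
  then show thesis using that[of "1 + C"] by (simp add: distrib_right)
qed

text \<open>
  If \<open>t \<noteq> 0\<close>, subtract a multiple of a coordinate to get \<open>h t = 0\<close>. The function
  \<open>d a = \<Sum>\<^sub>l \<bar>\<parallel>t\<parallel> a\<^sub>l - \<parallel>a\<parallel> t\<^sub>l\<bar>\<close> vanishes only on the ray through \<open>t\<close>, so that
  \<open>h \<le> \<epsilon> \<parallel>\<cdot>\<parallel> + C d\<close>, and \<open>\<phi>\<close> is evaluation at \<open>t\<close> on \<open>\<parallel>\<cdot>\<parallel>\<close> and \<open>d\<close>, which are lattice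
  polynomials in the coordinates.
\<close>

lemma lattice_hom_krivine_functions:
  fixes \<phi> :: "((nat \<Rightarrow> real) \<Rightarrow> real) \<Rightarrow> real"
  assumes add: "\<And>g h. g \<in> krivine_functions n \<Longrightarrow> h \<in> krivine_functions n \<Longrightarrow> \<phi> (\<lambda>a. g a + h a) = \<phi> g + \<phi> h"
    and scale: "\<And>c h. h \<in> krivine_functions n \<Longrightarrow> \<phi> (\<lambda>a. c * h a) = c * \<phi> h"
    and max: "\<And>g h. g \<in> krivine_functions n \<Longrightarrow> h \<in> krivine_functions n \<Longrightarrow>
      \<phi> (\<lambda>a. max (g a) (h a)) = max (\<phi> g) (\<phi> h)"
    and coord: "\<And>i. i < n \<Longrightarrow> \<phi> (\<lambda>a. a i) = t i"
    and h: "h \<in> krivine_functions n"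
  shows "\<phi> h = h t"
proof -
  \<comment> \<open>\<open>R\<close> collects the functions on which \<open>\<phi>\<close> is known
    to be evaluation at \<open>t\<close>. It contains the lattice polynomials in the coordinates,
    among them \<open>\<nu>\<close> and \<open>d\<close>. Since \<open>h\<close> is not known to lie
    in \<open>R\<close>, it is bounded by members of \<open>R\<close> instead.\<close>
  define R where "R = {h \<in> krivine_functions n. \<phi> h = h t}"
  have R_coord: "(\<lambda>a. a i) \<in> R" if "i < n" for i
    using that coord by (simp add: R_def krivine_functions_coord)
  have R_add: "(\<lambda>a. g a + f a) \<in> R" if "g \<in> R" "f \<in> R" for g f
    using that add by (simp add: R_def krivine_functions_add)
  have R_scale: "(\<lambda>a. c * f a) \<in> R" if "f \<in> R" for c f
    using that scale by (simp add: R_def krivine_functions_scale)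
  have R_abs: "(\<lambda>a. \<bar>f a\<bar>) \<in> R" if f: "f \<in> R" for f
  proof -
    have "(\<lambda>a. \<bar>f a\<bar>) = (\<lambda>a. max (f a) ((-1) * f a))" by (auto simp: fun_eq_iff)
    moreover have "\<phi> (\<lambda>a. max (f a) ((-1) * f a)) = max (f t) ((-1) * f t)"
      using f R_scale[OF f, of "-1"] by (subst max) (auto simp: R_def)
    ultimately have "\<phi> (\<lambda>a. \<bar>f a\<bar>) = \<bar>f t\<bar>" by (simp add: max_def)
    then show ?thesis using f krivine_functions_abs by (auto simp: R_def)
  qed
  have R_zero: "(\<lambda>_. 0) \<in> R"
    using scale[OF krivine_functions_zero, of 0] by (simp add: R_def krivine_functions_zero)
  have R_sum: "(\<lambda>a. \<Sum>j\<in>A. f j a) \<in> R" if "\<And>j. j \<in> A \<Longrightarrow> f j \<in> R" for A :: "nat set" and f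
    using that by (induction A rule: infinite_finite_induct) (auto intro: R_zero R_add)
  \<comment> \<open>Monotonicity comes from \<open>max\<close> alone, because
    \<open>f \<le> g\<close> means that the maximum of both is \<open>g\<close>.\<close>
  have mono: "\<phi> f \<le> \<phi> g" if "f \<in> krivine_functions n" "g \<in> krivine_functions n" "\<And>a. f a \<le> g a" for f g
  proof -
    have "(\<lambda>a. max (f a) (g a)) = g" using that by (auto simp: fun_eq_iff max_def)
    then show ?thesis using max[OF that(1,2)] by simp
  qed
  define \<nu> where "\<nu> = (\<lambda>a::nat \<Rightarrow> real. \<Sum>j<n. \<bar>a j\<bar>)"
  have \<nu>: "\<nu> \<in> R" unfolding \<nu>_def by (intro R_sum R_abs R_coord) auto
  have \<nu>_nonneg: "\<nu> a \<ge> 0" for a by (simp add: \<nu>_def sum_nonneg)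
  have upper: "\<phi> h \<le> h t" if h: "h \<in> krivine_functions n" for h
  proof (cases "\<exists>j<n. t j \<noteq> 0")
    \<comment> \<open>If \<open>t\<close> vanishes below \<open>n\<close>, there is no ray to
      compare with; a bound by a multiple of \<open>\<nu>\<close> suffices, as
      \<open>\<nu> t = 0\<close>.\<close>
    case False
    then have t: "t j = 0" if "j < n" for j using that by blast
    obtain C where C: "C \<ge> 0" "\<And>a. \<bar>h a\<bar> \<le> C * \<nu> a"
      using krivine_functions_abs_bound[OF h] unfolding \<nu>_def by blast
    have "h a \<le> C * \<nu> a" for a using C(2)[of a] by linarith
    then have "\<phi> h \<le> \<phi> (\<lambda>a. C * \<nu> a)" using h R_scale[OF \<nu>, of C] by (intro mono) (auto simp: R_def)
    also have "\<dots> = C * \<nu> t" using R_scale[OF \<nu>, of C] by (simp add: R_def)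
    also have "\<dots> = 0" using t by (simp add: \<nu>_def)
    also have "0 = h t" using krivine_functions_eq_0[OF h] t by simp
    finally show ?thesis .
  next
    case True
    then obtain j where j: "j < n" "t j \<noteq> 0" by blast
    have "\<bar>t j\<bar> \<le> \<nu> t" unfolding \<nu>_def using j by (intro member_le_sum[where f="\<lambda>j. \<bar>t j\<bar>"]) auto
    then have T: "\<nu> t > 0" using j by linarith
    define d where "d = (\<lambda>a. \<Sum>l<n. \<bar>\<nu> t * a l + (- t l) * \<nu> a\<bar>)"
    have d: "d \<in> R" unfolding d_def by (intro R_sum R_abs R_add R_scale R_coord \<nu>) auto
    define g where "g = (\<lambda>a. h a + (- (h t / t j)) * a j)"
    have g: "g \<in> krivine_functions n"
      unfolding g_def using j by (intro krivine_functions_add krivine_functions_scale krivine_functions_coord h)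
    have \<phi>g: "\<phi> g = \<phi> h - h t"
    proof -
      have "\<phi> g = \<phi> h + \<phi> (\<lambda>a. (- (h t / t j)) * a j)"
        unfolding g_def using j by (intro add h krivine_functions_scale krivine_functions_coord)
      also have "\<phi> (\<lambda>a. (- (h t / t j)) * a j) = (- (h t / t j)) * \<phi> (\<lambda>a. a j)"
        using j by (intro scale krivine_functions_coord)
      finally show ?thesis using j coord by simp
    qed
    have g_zero: "g a \<le> 0" if "d a = 0" for a
    proof -
      have "\<nu> t * a l = t l * \<nu> a" if "l < n" for l
        using \<open>d a = 0\<close> that unfolding d_def by (simp add: sum_nonneg_eq_0_iff)
      then have "g a = g (\<lambda>l. \<nu> a / \<nu> t * t l)"
        using T by (intro krivine_functions_cong[OF g]) (simp add: field_simps)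
      also have "\<dots> = \<nu> a / \<nu> t * g t"
        using T \<nu>_nonneg by (intro krivine_functions_homogeneous[OF g]) simp
      also have "g t = 0" using j by (simp add: g_def)
      finally show ?thesis by simp
    qed
    have "\<phi> g \<le> 0 + e" if e: "e > 0" for e
    proof -
      obtain C where C: "C \<ge> 0" "\<And>a. g a \<le> e / \<nu> t * \<nu> a + C * d a"
      proof (rule krivine_functions_bound[OF g])
        show "d \<in> krivine_functions n" using d by (simp add: R_def)
        show "e / \<nu> t > 0" using e T by simp
      qed (auto simp: \<nu>_def d_def sum_nonneg g_zero)
      have r: "(\<lambda>a. e / \<nu> t * \<nu> a + C * d a) \<in> R" by (intro R_add R_scale \<nu> d)
      have "\<phi> g \<le> \<phi> (\<lambda>a. e / \<nu> t * \<nu> a + C * d a)" using r C g by (intro mono) (auto simp: R_def)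
      also have "\<dots> = e / \<nu> t * \<nu> t + C * d t" using r by (simp add: R_def)
      also have "\<dots> = e" using T by (simp add: d_def)
      finally show ?thesis by simp
    qed
    then have "\<phi> g \<le> 0" by (rule field_le_epsilon)
    then show ?thesis using \<phi>g by simp
  qed
  \<comment> \<open>The upper bound for \<open>- h\<close> is the lower bound for
    \<open>h\<close>.\<close>
  have "\<phi> (\<lambda>a. (-1) * h a) \<le> (-1) * h t" by (intro upper krivine_functions_scale h)
  then show ?thesis using upper[OF h] scale[OF h, of "-1"] by simp
qed

section \<open>The lattice \<open>\<ell>\<^sup>\<infinity>(I, \<ell>\<^sup>1)\<close>\<close>

text \<open>Pointwise scaling turns both the families in the lattice and the formal combinations
  used later into real vectors, so that the theory of \<open>subspace\<close> applies to
  them.\<close>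

instantiation "fun" :: (type, real_vector) real_vector
begin

definition "c *\<^sub>R f = (\<lambda>x. c *\<^sub>R f x)"

instance
  by standard (simp_all add: scaleR_fun_def fun_eq_iff algebra_simps)

end

lemma scaleR_fun_apply [simp]: "(c *\<^sub>R f) x = c *\<^sub>R f x"
  by (simp add: scaleR_fun_def)

lemma sum_fun_apply [simp]: "(\<Sum>j\<in>A. f j) x = (\<Sum>j\<in>A. f j x)"
  by (induction A rule: infinite_finite_induct) auto

lemma linf_l1_carrier_iff:
  "x \<in> vcarrier (linf_l1 I) \<longleftrightarrow>
    (\<forall>i. i \<notin> I \<longrightarrow> x i = (\<lambda>_. 0)) \<and> (\<forall>i\<in>I. summable (\<lambda>k. \<bar>x i k\<bar>)) \<and>
    (\<exists>B. \<forall>i\<in>I. (\<Sum>k. \<bar>x i k\<bar>) \<le> B)"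
  by (simp add: linf_l1_def bdd_above_def)

lemma linf_l1_simps [simp]:
  "vzero (linf_l1 I) = 0" "vadd (linf_l1 I) = (+)" "vscale (linf_l1 I) = (*\<^sub>R)"
  by (auto simp: linf_l1_def fun_eq_iff)

lemma linf_l1_summable:
  assumes "x \<in> vcarrier (linf_l1 I)"
  shows "summable (\<lambda>k. \<bar>x i k\<bar>)"
  using assms by (cases "i \<in> I") (auto simp: linf_l1_carrier_iff)

lemma linf_l1_norm_le:
  assumes "\<And>i. i \<in> I \<Longrightarrow> (\<Sum>k. \<bar>x i k\<bar>) \<le> B" "0 \<le> B"
  shows "vnorm (linf_l1 I) x \<le> B"
  using assms by (auto simp: linf_l1_def intro!: cSup_least)

lemma linf_l1_norm_ge:
  assumes "x \<in> vcarrier (linf_l1 I)" "i \<in> I"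
  shows "(\<Sum>k. \<bar>x i k\<bar>) \<le> vnorm (linf_l1 I) x"
  using assms by (auto simp: linf_l1_def intro!: cSup_upper)

lemma linf_l1_norm_nonneg:
  assumes "x \<in> vcarrier (linf_l1 I)"
  shows "0 \<le> vnorm (linf_l1 I) x"
  using assms by (auto simp: linf_l1_def intro!: cSup_upper)

lemma linf_l1_carrier_bound:
  assumes "\<And>i. i \<notin> I \<Longrightarrow> x i = (\<lambda>_. 0)"
    and "\<And>i. i \<in> I \<Longrightarrow> summable (\<lambda>k. \<bar>x i k\<bar>) \<and> (\<Sum>k. \<bar>x i k\<bar>) \<le> B"
  shows "x \<in> vcarrier (linf_l1 I)"
  using assms by (auto simp: linf_l1_carrier_iff)

lemma linf_l1_carrier_subspace: "subspace (vcarrier (linf_l1 I))"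
proof (rule subspaceI)
  show "0 \<in> vcarrier (linf_l1 I)" by (auto simp: linf_l1_carrier_iff)
next
  fix x y assume xy: "x \<in> vcarrier (linf_l1 I)" "y \<in> vcarrier (linf_l1 I)"
  note s = linf_l1_summable[OF xy(1)] linf_l1_summable[OF xy(2)]
  show "x + y \<in> vcarrier (linf_l1 I)"
  proof (rule linf_l1_carrier_bound)
    fix i assume i: "i \<in> I"
    have le: "\<bar>(x + y) i k\<bar> \<le> \<bar>x i k\<bar> + \<bar>y i k\<bar>" for k by simp
    have sum: "summable (\<lambda>k. \<bar>(x + y) i k\<bar>)"
      by (rule summable_comparison_test'[OF summable_add[OF s]]) (use le in auto)
    moreover have "(\<Sum>k. \<bar>(x + y) i k\<bar>) \<le> (\<Sum>k. \<bar>x i k\<bar> + \<bar>y i k\<bar>)"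
      by (intro suminf_le le sum summable_add s)
    moreover have "\<dots> = (\<Sum>k. \<bar>x i k\<bar>) + (\<Sum>k. \<bar>y i k\<bar>)" by (intro suminf_add[symmetric] s)
    moreover have "\<dots> \<le> vnorm (linf_l1 I) x + vnorm (linf_l1 I) y"
      by (intro add_mono linf_l1_norm_ge xy i)
    ultimately show "summable (\<lambda>k. \<bar>(x + y) i k\<bar>) \<and>
        (\<Sum>k. \<bar>(x + y) i k\<bar>) \<le> vnorm (linf_l1 I) x + vnorm (linf_l1 I) y" by simp
  qed (use xy in \<open>auto simp: linf_l1_carrier_iff\<close>)
next
  fix c :: real and x assume x: "x \<in> vcarrier (linf_l1 I)"
  show "c *\<^sub>R x \<in> vcarrier (linf_l1 I)"
    by (rule linf_l1_carrier_bound[where B = "\<bar>c\<bar> * vnorm (linf_l1 I) x"])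
      (use x linf_l1_summable[OF x] linf_l1_norm_ge[OF x] in
       \<open>auto simp: linf_l1_carrier_iff abs_mult suminf_mult summable_mult intro!: mult_left_mono\<close>)
qed

text \<open>Solidity of the lattice and monotonicity of its norm. Membership of joins and of values
  of the functional calculus follows from it, because both are dominated by combinations of absolute
  values.\<close>

lemma linf_l1_dominated:
  assumes x: "x \<in> vcarrier (linf_l1 I)" and le: "\<And>i k. \<bar>z i k\<bar> \<le> \<bar>x i k\<bar>"
  shows "z \<in> vcarrier (linf_l1 I)" "vnorm (linf_l1 I) z \<le> vnorm (linf_l1 I) x"
proof -
  have s: "summable (\<lambda>k. \<bar>z i k\<bar>)" for i
    by (rule summable_comparison_test'[OF linf_l1_summable[OF x, of i]]) (use le in auto)
  have b: "(\<Sum>k. \<bar>z i k\<bar>) \<le> vnorm (linf_l1 I) x" if "i \<in> I" for i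
    using suminf_le[OF le[of i] s linf_l1_summable[OF x]] linf_l1_norm_ge[OF x that] by linarith
  have "z i = (\<lambda>_. 0)" if "i \<notin> I" for i
  proof
    show "z i k = 0" for k using that x le[of i k] by (simp add: linf_l1_carrier_iff)
  qed
  then show "z \<in> vcarrier (linf_l1 I)" using s b by (intro linf_l1_carrier_bound) auto
  show "vnorm (linf_l1 I) z \<le> vnorm (linf_l1 I) x" using b linf_l1_norm_nonneg[OF x] by (intro linf_l1_norm_le)
qed

lemma linf_l1_norm_triangle:
  assumes xy: "x \<in> vcarrier (linf_l1 I)" "y \<in> vcarrier (linf_l1 I)"
  shows "vnorm (linf_l1 I) (x + y) \<le> vnorm (linf_l1 I) x + vnorm (linf_l1 I) y"
proof (rule linf_l1_norm_le)
  fix i assume i: "i \<in> I"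
  note s = linf_l1_summable[OF xy(1)] linf_l1_summable[OF xy(2)]
  have "x + y \<in> vcarrier (linf_l1 I)" using linf_l1_carrier_subspace xy by (rule subspace_add)
  from linf_l1_summable[OF this, of i]
  have "(\<Sum>k. \<bar>(x + y) i k\<bar>) \<le> (\<Sum>k. \<bar>x i k\<bar> + \<bar>y i k\<bar>)"
    by (intro suminf_le summable_add s) auto
  also have "\<dots> = (\<Sum>k. \<bar>x i k\<bar>) + (\<Sum>k. \<bar>y i k\<bar>)" by (intro suminf_add[symmetric] s)
  also have "\<dots> \<le> vnorm (linf_l1 I) x + vnorm (linf_l1 I) y"
    by (intro add_mono linf_l1_norm_ge xy i)
  finally show "(\<Sum>k. \<bar>(x + y) i k\<bar>) \<le> vnorm (linf_l1 I) x + vnorm (linf_l1 I) y" .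
qed (intro add_nonneg_nonneg linf_l1_norm_nonneg xy)

lemma linf_l1_norm_scale:
  assumes x: "x \<in> vcarrier (linf_l1 I)"
  shows "vnorm (linf_l1 I) (c *\<^sub>R x) \<le> \<bar>c\<bar> * vnorm (linf_l1 I) x"
  by (rule linf_l1_norm_le)
    (use linf_l1_summable[OF x] linf_l1_norm_ge[OF x] linf_l1_norm_nonneg[OF x] in
      \<open>auto simp: abs_mult suminf_mult intro!: mult_left_mono\<close>)

lemma linf_l1_abs: "x \<in> vcarrier (linf_l1 I) \<Longrightarrow> (\<lambda>i k. \<bar>x i k\<bar>) \<in> vcarrier (linf_l1 I)"
  by (erule linf_l1_dominated(1)) auto

section \<open>Joins and the Krivine calculus in the lattice\<close>

lemma is_join_linf_l1_iff:
  assumes f: "f \<in> vcarrier (linf_l1 I)" and g: "g \<in> vcarrier (linf_l1 I)"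
  shows "is_join (linf_l1 I) f g z \<longleftrightarrow> z = (\<lambda>i k. max (f i k) (g i k))"
proof -
  let ?m = "\<lambda>i k. max (f i k) (g i k)"
  have m: "?m \<in> vcarrier (linf_l1 I)"
    by (rule linf_l1_dominated(1)[OF subspace_add[OF linf_l1_carrier_subspace linf_l1_abs[OF f] linf_l1_abs[OF g]]]) auto
  have le: "vle (linf_l1 I) x y \<longleftrightarrow> (\<forall>i\<in>I. \<forall>k. x i k \<le> y i k)" for x y
    by (simp add: linf_l1_def)
  show ?thesis
  proof
    assume z: "is_join (linf_l1 I) f g z"
    then have "\<forall>i\<in>I. \<forall>k. z i k \<le> ?m i k" using m by (auto simp: is_join_def le)
    moreover have "\<forall>i\<in>I. \<forall>k. ?m i k \<le> z i k" using z by (auto simp: is_join_def le)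
    \<comment> \<open>The order does not see indices outside \<open>I\<close>; there all members of
      the carrier vanish.\<close>
    moreover have "z i k = ?m i k" if "i \<notin> I" for i k
      using z f g that by (simp add: is_join_def linf_l1_carrier_iff)
    ultimately show "z = ?m" by (intro ext) (metis order.antisym)
  qed (use m in \<open>auto simp: is_join_def le\<close>)
qed

text \<open>A homogeneous function is dominated by a multiple of the l1 norm of its arguments, so
  solidity applies.\<close>

lemma linf_l1_pointwise_carrier:
  assumes h: "h \<in> krivine_functions n" and x: "\<And>j. j < n \<Longrightarrow> x j \<in> vcarrier (linf_l1 I)"
  shows "(\<lambda>i k. h (\<lambda>j. x j i k)) \<in> vcarrier (linf_l1 I)"
proof -
  obtain C where C: "C \<ge> 0" "\<And>a. \<bar>h a\<bar> \<le> C * (\<Sum>j<n. \<bar>a j\<bar>)"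
    using krivine_functions_abs_bound[OF h] by blast
  have "C *\<^sub>R (\<Sum>j<n. (\<lambda>i k. \<bar>x j i k\<bar>)) \<in> vcarrier (linf_l1 I)"
    by (intro subspace_scale subspace_sum linf_l1_carrier_subspace linf_l1_abs x) auto
  then show ?thesis by (rule linf_l1_dominated(1)) (use C in \<open>auto simp: abs_mult sum_nonneg\<close>)
qed

text \<open>Pointwise application is a Krivine homomorphism. It is the only one, because each
  coordinate \<open>(i, k)\<close> of such a homomorphism is a real lattice homomorphism and hence
  evaluation at the point \<open>x j i k\<close>.\<close>

lemma krivine_linf_l1:
  assumes h: "h \<in> krivine_functions n" and x: "\<And>j. j < n \<Longrightarrow> x j \<in> vcarrier (linf_l1 I)"
  shows "krivine (linf_l1 I) n x h = (\<lambda>i k. h (\<lambda>j. x j i k))"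
  unfolding krivine_def
proof (rule the_equality)
  let ?\<Phi> = "\<lambda>h i k. h (\<lambda>j. x j i k)"
  have "krivine_hom (linf_l1 I) n x ?\<Phi>"
    unfolding krivine_hom_def
    by (auto simp: is_join_linf_l1_iff linf_l1_pointwise_carrier x fun_eq_iff)
  then show "\<exists>\<Phi>. krivine_hom (linf_l1 I) n x \<Phi> \<and> \<Phi> h = ?\<Phi> h" by blast
next
  fix y assume "\<exists>\<Phi>. krivine_hom (linf_l1 I) n x \<Phi> \<and> \<Phi> h = y"
  then obtain \<Phi> where hom: "krivine_hom (linf_l1 I) n x \<Phi>" and y: "y = \<Phi> h" by blast
  have "\<Phi> h i k = h (\<lambda>j. x j i k)" for i k
  proof (rule lattice_hom_krivine_functions[where \<phi> = "\<lambda>h. \<Phi> h i k" and n = n])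
    fix f g assume fg: "f \<in> krivine_functions n" "g \<in> krivine_functions n"
    then have "is_join (linf_l1 I) (\<Phi> f) (\<Phi> g) (\<Phi> (\<lambda>a. max (f a) (g a)))"
      "\<Phi> f \<in> vcarrier (linf_l1 I)" "\<Phi> g \<in> vcarrier (linf_l1 I)"
      using hom unfolding krivine_hom_def by blast+
    then show "\<Phi> (\<lambda>a. max (f a) (g a)) i k = max (\<Phi> f i k) (\<Phi> g i k)"
      by (simp add: is_join_linf_l1_iff)
  qed (use hom h in \<open>simp_all add: krivine_hom_def\<close>)
  then show "y = (\<lambda>i k. h (\<lambda>j. x j i k))" using y by (simp add: fun_eq_iff)
qed

lemma linf_l1_norm_zero: "vnorm (linf_l1 I) 0 = 0"
  by (auto simp: linf_l1_def image_constant_conv)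

lemma linf_l1_norm_uminus: "x \<in> vcarrier (linf_l1 I) \<Longrightarrow> vnorm (linf_l1 I) (- x) \<le> vnorm (linf_l1 I) x"
  using linf_l1_norm_scale[of x I "-1"] by simp

lemma linf_l1_norm_sum:
  assumes "\<And>j. j \<in> A \<Longrightarrow> z j \<in> vcarrier (linf_l1 I)"
  shows "vnorm (linf_l1 I) (\<Sum>j\<in>A. z j) \<le> (\<Sum>j\<in>A. vnorm (linf_l1 I) (z j))"
  using assms
proof (induction A rule: infinite_finite_induct)
  case (insert a A)
  have "vnorm (linf_l1 I) (z a + (\<Sum>j\<in>A. z j)) \<le> vnorm (linf_l1 I) (z a) + vnorm (linf_l1 I) (\<Sum>j\<in>A. z j)"
    using insert by (intro linf_l1_norm_triangle subspace_sum[OF linf_l1_carrier_subspace]) auto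
  then show ?case using insert by (simp del: sum_fun_apply plus_fun_apply)
qed (simp_all add: linf_l1_norm_zero)

lemma natural_multinorm_simps [simp]:
  "vcarrier (natural_multinorm p E) = vcarrier E" "vzero (natural_multinorm p E) = vzero E"
  "vadd (natural_multinorm p E) = vadd E" "vscale (natural_multinorm p E) = vscale E"
  "vnorm (natural_multinorm p E) = vnorm E"
  by (simp_all add: natural_multinorm_def)

lemma mnorm_natural_linf_l1:
  assumes "1 \<le> p" "n \<ge> 1" "\<And>j. j < n \<Longrightarrow> x j \<in> vcarrier (linf_l1 I)"
  shows "mnorm (natural_multinorm p (linf_l1 I)) n x = vnorm (linf_l1 I) (\<lambda>i k. lp_norm p n (\<lambda>j. x j i k))"
  using assms by (simp add: natural_multinorm_def krivine_linf_l1 lp_norm_in_krivine_functions)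

section \<open>Subspaces of quotients\<close>

text \<open>
  \<open>lift\<close> is linear only modulo \<open>Z\<close>. The bounds \<open>norm_upper\<close> and \<open>tensor_upper\<close> make the infima in the
  quotient norms minima.
\<close>

locale lift_to_quotient =
  fixes V :: "'v::real_vector multinormed_structure" and Z :: "'v set"
    and N :: "nat \<Rightarrow> (nat \<Rightarrow> 'a::banach) \<Rightarrow> real" and lift :: "'a \<Rightarrow> 'v"
  assumes zero: "vzero V = 0" and add: "vadd V = (+)" and scale: "vscale V = (*\<^sub>R)"
    and carrier: "subspace (vcarrier V)"
    and closed_Z: "closed_subspace V Z"
    and norm_zero: "vnorm V 0 = 0"
    and norm_nonneg: "v \<in> vcarrier V \<Longrightarrow> 0 \<le> vnorm V v"
    and norm_triangle: "v \<in> vcarrier V \<Longrightarrow> v' \<in> vcarrier V \<Longrightarrow> vnorm V (v + v') \<le> vnorm V v + vnorm V v'"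
    and norm_uminus: "v \<in> vcarrier V \<Longrightarrow> vnorm V (- v) \<le> vnorm V v"
    and lift_carrier: "lift x \<in> vcarrier V"
    and lift_add: "lift (x + y) - (lift x + lift y) \<in> Z"
    and lift_scale: "lift (c *\<^sub>R x) - c *\<^sub>R lift x \<in> Z"
    and norm_lower: "v \<in> vcarrier V \<Longrightarrow> v - lift x \<in> Z \<Longrightarrow> norm x \<le> vnorm V v"
    and norm_upper: "\<exists>v\<in>vcarrier V. v - lift x \<in> Z \<and> vnorm V v \<le> norm x"
    and tensor_lower: "n \<ge> 1 \<Longrightarrow> w \<in> supported_below n \<Longrightarrow> t \<in> tensors n V \<Longrightarrow>
      (\<And>i. i < n \<Longrightarrow> t i - lift (w i) \<in> Z) \<Longrightarrow> N n w \<le> mnorm V n t"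
    and tensor_upper: "n \<ge> 1 \<Longrightarrow> w \<in> supported_below n \<Longrightarrow>
      \<exists>v\<in>tensors n V. (\<forall>i<n. v i - lift (w i) \<in> Z) \<and> mnorm V n v \<le> N n w"
begin

section \<open>Cosets and the operations of the quotient\<close>

lemma Z_subset: "Z \<subseteq> vcarrier V"
  using closed_Z by (simp add: closed_subspace_def)

lemma subspace_Z: "subspace Z"
  using closed_Z by (auto simp: closed_subspace_def subspace_def zero add scale)

lemma Z_add: "a \<in> Z \<Longrightarrow> b \<in> Z \<Longrightarrow> c = a + b \<Longrightarrow> c \<in> Z"
  using subspace_add[OF subspace_Z] by simp

lemma Z_diff: "a \<in> Z \<Longrightarrow> b \<in> Z \<Longrightarrow> c = a - b \<Longrightarrow> c \<in> Z"
  using subspace_diff[OF subspace_Z] by simp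

lemma Z_closed:
  assumes "\<And>k. s k \<in> Z" "x \<in> vcarrier V" "(\<lambda>k. vnorm V (s k - x)) \<longlonglongrightarrow> 0"
  shows "x \<in> Z"
proof -
  have "\<forall>s. \<forall>x\<in>vcarrier V. (\<forall>k. s k \<in> Z) \<and> (\<lambda>k. vnorm V (s k + (-1) *\<^sub>R x)) \<longlonglongrightarrow> 0 \<longrightarrow> x \<in> Z"
    using closed_Z unfolding closed_subspace_def add scale by blast
  from this[rule_format, OF assms(2), of s] assms(1,3) show ?thesis by simp
qed

definition coset :: "'v \<Rightarrow> 'v set" where
  "coset x = (+) x ` Z"

lemma mem_coset: "v \<in> coset x \<longleftrightarrow> v - x \<in> Z"
  by (force simp: coset_def image_iff algebra_simps)

lemma coset_eq_iff: "coset x = coset y \<longleftrightarrow> x - y \<in> Z"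
proof
  assume "coset x = coset y"
  moreover have "x \<in> coset x" using subspace_0[OF subspace_Z] by (simp add: mem_coset)
  ultimately show "x - y \<in> Z" by (simp add: mem_coset)
next
  assume xy: "x - y \<in> Z"
  have "v - x \<in> Z \<longleftrightarrow> v - y \<in> Z" for v
  proof
    assume "v - x \<in> Z"
    from this xy show "v - y \<in> Z" by (rule Z_add) simp
  next
    assume "v - y \<in> Z"
    from this xy show "v - x \<in> Z" by (rule Z_diff) simp
  qed
  then show "coset x = coset y" by (auto simp: set_eq_iff mem_coset)
qed

lemma coset_add: "{a + b | a b. a \<in> coset x \<and> b \<in> coset y} = coset (x + y)"
proof (intro set_eqI iffI)
  fix v assume "v \<in> coset (x + y)"
  then have "v = (v - y) + y" "v - y \<in> coset x" "y \<in> coset y"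
    using subspace_0[OF subspace_Z] by (auto simp: mem_coset algebra_simps)
  then show "v \<in> {a + b | a b. a \<in> coset x \<and> b \<in> coset y}" by blast
next
  fix v assume "v \<in> {a + b | a b. a \<in> coset x \<and> b \<in> coset y}"
  then obtain a b where v: "v = a + b" and ab: "a - x \<in> Z" "b - y \<in> Z" by (auto simp: mem_coset)
  show "v \<in> coset (x + y)" unfolding mem_coset by (rule Z_add[OF ab]) (simp add: v)
qed

lemma coset_scale: "{c *\<^sub>R a + z | a z. a \<in> coset x \<and> z \<in> Z} = coset (c *\<^sub>R x)"
proof (intro set_eqI iffI)
  fix v assume "v \<in> coset (c *\<^sub>R x)"
  then have "v = c *\<^sub>R x + (v - c *\<^sub>R x)" "x \<in> coset x" "v - c *\<^sub>R x \<in> Z"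
    using subspace_0[OF subspace_Z] by (auto simp: mem_coset)
  then show "v \<in> {c *\<^sub>R a + z | a z. a \<in> coset x \<and> z \<in> Z}" by blast
next
  fix v assume "v \<in> {c *\<^sub>R a + z | a z. a \<in> coset x \<and> z \<in> Z}"
  then obtain a z where v: "v = c *\<^sub>R a + z" and az: "a - x \<in> Z" "z \<in> Z" by (auto simp: mem_coset)
  show "v \<in> coset (c *\<^sub>R x)" unfolding mem_coset
    by (rule Z_add[OF subspace_scale[OF subspace_Z az(1), of c] az(2)]) (simp add: v algebra_simps)
qed

lemma coset_subset: "x \<in> vcarrier V \<Longrightarrow> v \<in> coset x \<Longrightarrow> v \<in> vcarrier V"
  unfolding coset_def using Z_subset subspace_add[OF carrier] by blast

lemma quotient_by_simps [simp]:
  "vcarrier (quotient_by V Z) = coset ` vcarrier V"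
  "vzero (quotient_by V Z) = coset 0"
  "vadd (quotient_by V Z) = (\<lambda>A B. {a + b | a b. a \<in> A \<and> b \<in> B})"
  "vscale (quotient_by V Z) = (\<lambda>c A. {c *\<^sub>R a + z | a z. a \<in> A \<and> z \<in> Z})"
  "vnorm (quotient_by V Z) = (\<lambda>A. INF a\<in>A. vnorm V a)"
  "mnorm (quotient_by V Z) = (\<lambda>n W. INF w\<in>{w \<in> tensors n V. \<forall>i<n. w i \<in> W i}. mnorm V n w)"
  by (simp_all add: quotient_by_def add scale coset_def image_image fun_eq_iff)

lemma lift_diff: "lift (x - y) - (lift x - lift y) \<in> Z"
proof (rule Z_add[OF lift_add[of x "(-1) *\<^sub>R y"] lift_scale[of "-1" y]])
  show "lift (x - y) - (lift x - lift y) =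
    lift (x + (-1) *\<^sub>R y) - (lift x + lift ((-1) *\<^sub>R y)) + (lift ((-1) *\<^sub>R y) - (-1) *\<^sub>R lift y)" by simp
qed

section \<open>The image of \<open>X\<close> in the quotient\<close>

definition embed :: "'a \<Rightarrow> 'v set" where
  "embed x = coset (lift x)"

lemma embed_add: "embed (x + y) = {a + b | a b. a \<in> embed x \<and> b \<in> embed y}"
  unfolding embed_def coset_add coset_eq_iff by (rule lift_add)

lemma embed_scale: "embed (c *\<^sub>R x) = {c *\<^sub>R a + z | a z. a \<in> embed x \<and> z \<in> Z}"
  unfolding embed_def coset_scale coset_eq_iff by (rule lift_scale)

lemma embed_zero: "embed 0 = coset 0"
  using lift_scale[of 0 0] by (simp add: embed_def coset_eq_iff)

text \<open>If two points have the same coset, then \<open>0\<close> represents the class of their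
  difference, and \<open>norm_lower\<close> forces the difference to vanish.\<close>

lemma inj_embed: "inj embed"
proof (rule injI)
  fix x y assume "embed x = embed y"
  then have "lift x - lift y \<in> Z" by (simp add: embed_def coset_eq_iff)
  with lift_diff[of x y] have "lift (x - y) \<in> Z" by (rule Z_add) simp
  then have "0 - lift (x - y) \<in> Z" using subspace_neg[OF subspace_Z] by simp
  then have "norm (x - y) \<le> 0" using norm_lower[of 0] norm_zero subspace_0[OF carrier] by metis
  then show "x = y" by simp
qed

text \<open>Completeness of \<open>X\<close> passes to its image, which is therefore closed.\<close>

lemma embed_limit:
  assumes a: "a \<in> vcarrier V" and lim: "(\<lambda>k. INF v\<in>coset (lift (y k) - a). vnorm V v) \<longlonglongrightarrow> 0"
  shows "coset a \<in> range embed"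
proof -
  \<comment> \<open>The added null sequence gives room for representatives whose norm lies strictly
    below \<open>\<delta> k\<close>, since the infimum need not be attained for
    \<open>a\<close>.\<close>
  define \<delta> where "\<delta> k = (INF v\<in>coset (lift (y k) - a). vnorm V v) + 1 / real (Suc k)" for k
  have "(\<lambda>k. 1 / real (Suc k)) \<longlonglongrightarrow> 0" using LIMSEQ_inverse_real_of_nat by (simp add: inverse_eq_divide)
  from tendsto_add[OF lim this] have \<delta>: "\<delta> \<longlonglongrightarrow> 0" by (simp add: \<delta>_def [abs_def])
  have "\<exists>v. v - (lift (y k) - a) \<in> Z \<and> vnorm V v < \<delta> k" for k
  proof -
    have "coset (lift (y k) - a) \<noteq> {}" using subspace_0[OF subspace_Z] by (auto simp: coset_def)
    then have "\<exists>r\<in>vnorm V ` coset (lift (y k) - a). r < \<delta> k"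
      by (intro cInf_lessD) (auto simp: \<delta>_def)
    then show ?thesis by (auto simp: mem_coset)
  qed
  then obtain v where v: "\<And>k. v k - (lift (y k) - a) \<in> Z" "\<And>k. vnorm V (v k) < \<delta> k"
    by metis
  have vV: "v k \<in> vcarrier V" for k
    by (rule coset_subset[of "lift (y k) - a"])
      (use v a in \<open>auto simp: mem_coset intro: subspace_diff[OF carrier] lift_carrier\<close>)
  \<comment> \<open>\<open>v k - v l\<close> represents \<open>y k - y l\<close>, so
    \<open>norm_lower\<close> turns smallness in the quotient into a Cauchy estimate in
    \<open>X\<close>.\<close>
  have dist: "norm (y k - y l) \<le> \<delta> k + \<delta> l" for k l
  proof -
    have "(v k - v l) - (lift (y k) - lift (y l)) \<in> Z"
      by (rule Z_diff[OF v(1)[of k] v(1)[of l]]) (simp add: algebra_simps)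
    from Z_diff[OF this lift_diff[of "y k" "y l"]] have "(v k - v l) - lift (y k - y l) \<in> Z" by simp
    then have "norm (y k - y l) \<le> vnorm V (v k - v l)"
      by (intro norm_lower subspace_diff[OF carrier] vV)
    also have "\<dots> \<le> vnorm V (v k) + vnorm V (- v l)"
      using norm_triangle[of "v k" "- v l"] vV subspace_neg[OF carrier] by simp
    also have "\<dots> \<le> \<delta> k + \<delta> l" using norm_uminus[OF vV, of l] v(2)[of k] v(2)[of l] by linarith
    finally show ?thesis .
  qed
  have "Cauchy y"
  proof (rule metric_CauchyI)
    fix e :: real assume "e > 0"
    then have "\<forall>\<^sub>F k in sequentially. \<delta> k < e / 2" using order_tendstoD(2)[OF \<delta>, of "e / 2"] by simp
    then obtain M where M: "\<delta> k < e / 2" if "k \<ge> M" for k by (auto simp: eventually_sequentially)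
    have "dist (y k) (y l) < e" if "k \<ge> M" "l \<ge> M" for k l
      using dist[of k l] M[OF that(1)] M[OF that(2)] by (simp add: dist_norm)
    then show "\<exists>M. \<forall>m\<ge>M. \<forall>n\<ge>M. dist (y m) (y n) < e" by blast
  qed
  then obtain x where x: "y \<longlonglongrightarrow> x" using Cauchy_convergent_iff convergent_def by blast
  have "\<exists>r. r \<in> vcarrier V \<and> r - lift (x - y k) \<in> Z \<and> vnorm V r \<le> norm (x - y k)" for k
    using norm_upper by blast
  then obtain r where r: "\<And>k. r k \<in> vcarrier V" "\<And>k. r k - lift (x - y k) \<in> Z"
      "\<And>k. vnorm V (r k) \<le> norm (x - y k)"
    by metis
  \<comment> \<open>Modulo \<open>Z\<close>, \<open>v k\<close> is \<open>lift (y k) - a\<close> and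
    \<open>r k\<close> is \<open>lift x - lift (y k)\<close>. Their sum is congruent to
    \<open>lift x - a\<close> and tends to \<open>0\<close> in norm, so closedness of
    \<open>Z\<close> applies.\<close>
  have "a - lift x \<in> Z"
  proof (rule Z_closed)
    fix k
    have "r k - (lift x - lift (y k)) \<in> Z" 
      by (rule Z_add[OF r(2)[of k] lift_diff[of x "y k"]]) simp
    then show "a - lift x + (v k + r k) \<in> Z"
      by (rule Z_add[OF v(1)[of k]]) (simp add: algebra_simps)
  next
    show "(\<lambda>k. vnorm V (a - lift x + (v k + r k) - (a - lift x))) \<longlonglongrightarrow> 0"
    proof (rule Lim_null_comparison)
      have "norm (vnorm V (v k + r k)) \<le> \<delta> k + norm (x - y k)" for k
        using norm_triangle[OF vV r(1), of k k] v(2)[of k] r(3)[of k]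
          norm_nonneg[OF subspace_add[OF carrier vV r(1)], of k k] by simp
      then show "\<forall>\<^sub>F k in sequentially. norm (vnorm V (a - lift x + (v k + r k) - (a - lift x))) \<le> \<delta> k + norm (x - y k)"
        by (intro always_eventually) simp
      show "(\<lambda>k. \<delta> k + norm (x - y k)) \<longlonglongrightarrow> 0"
        using tendsto_add[OF \<delta> tendsto_norm[OF tendsto_diff[OF tendsto_const[of x] x]]] by simp
    qed
  qed (intro subspace_diff[OF carrier] a lift_carrier)
  then show ?thesis by (auto simp: embed_def coset_eq_iff)
qed

lemma closed_subspace_range_embed: "closed_subspace (quotient_by V Z) (range embed)"
  unfolding closed_subspace_def
proof (intro conjI allI ballI impI)
  show "range embed \<subseteq> vcarrier (quotient_by V Z)" using lift_carrier by (auto simp: embed_def)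
  show "vzero (quotient_by V Z) \<in> range embed" using embed_zero by (metis quotient_by_simps(2) rangeI)
next
  fix A B assume "A \<in> range embed" "B \<in> range embed"
  then show "vadd (quotient_by V Z) A B \<in> range embed" by (auto simp flip: embed_add)
next
  fix c A assume "A \<in> range embed"
  then show "vscale (quotient_by V Z) c A \<in> range embed" by (auto simp flip: embed_scale)
next
  fix s A
  assume "A \<in> vcarrier (quotient_by V Z)"
    and s: "(\<forall>k. s k \<in> range embed) \<and>
      (\<lambda>k. vnorm (quotient_by V Z) (vadd (quotient_by V Z) (s k) (vscale (quotient_by V Z) (- 1) A))) \<longlonglongrightarrow> 0"
  then obtain a where a: "a \<in> vcarrier V" "A = coset a" by auto
  have "\<forall>k. \<exists>x. s k = embed x" using s by blast
  then obtain y where y: "\<And>k. s k = embed (y k)" by metis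
  have "vadd (quotient_by V Z) (s k) (vscale (quotient_by V Z) (- 1) A) = coset (lift (y k) - a)" for k
    unfolding a y embed_def quotient_by_simps coset_scale coset_add by simp
  then show "A \<in> range embed" using embed_limit[OF a(1), of y] s a(2) by simp
qed

lemma mnorm_embed:
  assumes n: "n \<ge> 1" and w: "w \<in> supported_below n"
  shows "mnorm (quotient_by V Z) n (embed \<circ> w) = N n w"
proof -
  let ?S = "{v \<in> tensors n V. \<forall>i<n. v i \<in> (embed \<circ> w) i}"
  have S: "v \<in> ?S \<longleftrightarrow> v \<in> tensors n V \<and> (\<forall>i<n. v i - lift (w i) \<in> Z)" for v
    by (simp add: embed_def mem_coset)
  have lower: "N n w \<le> mnorm V n v" if "v \<in> ?S" for v
    using that n w unfolding S by (intro tensor_lower) auto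
  obtain v where v: "v \<in> ?S" "mnorm V n v \<le> N n w" using tensor_upper[OF n w] unfolding S by blast
  then have "mnorm V n v = N n w" using lower by (intro order.antisym)
  then have "(INF v\<in>?S. mnorm V n v) = N n w"
    using v(1) lower by (intro cInf_eq_minimum) force+
  then show ?thesis by simp
qed

lemma multiisometric_range_embed:
  "multiisometric (multinormed_space N) (subspace_of (quotient_by V Z) (range embed))"
  unfolding multiisometric_def
proof (intro exI[of _ embed] conjI)
  show "bij_betw embed (vcarrier (multinormed_space N)) (vcarrier (subspace_of (quotient_by V Z) (range embed)))"
    using inj_embed by (simp add: bij_betw_def multinormed_space_def subspace_of_def)
  have "tensors n (multinormed_space N) = supported_below n" for n
    by (auto simp: tensors_def multinormed_space_def supported_below_def)
  then show "\<forall>n\<ge>1. \<forall>w\<in>tensors n (multinormed_space N).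
      mnorm (subspace_of (quotient_by V Z) (range embed)) n (embed \<circ> w) = mnorm (multinormed_space N) n w"
    using mnorm_embed by (simp add: subspace_of_def multinormed_space_def)
qed (auto simp: multinormed_space_def subspace_of_def embed_add embed_scale)

end

section \<open>A lattice over a multinormed space\<close>

context p_multinormed
begin

lemma N_zero: "n \<ge> 1 \<Longrightarrow> N n (\<lambda>_. 0) = 0"
  using eq_zero[of n "\<lambda>_. 0"] by (simp add: supported_below_def)

lemma N_sum:
  assumes n: "n \<ge> 1" and v: "\<And>s. s \<in> A \<Longrightarrow> v s \<in> supported_below n"
  shows "N n (\<lambda>j. \<Sum>s\<in>A. v s j) \<le> (\<Sum>s\<in>A. N n (v s))"
  using v
proof (induction A rule: infinite_finite_induct)
  case (insert a A)
  have "(\<lambda>j. \<Sum>s\<in>A. v s j) \<in> supported_below n" using insert by (auto simp: supported_below_def)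
  then have "N n (\<lambda>j. v a j + (\<Sum>s\<in>A. v s j)) \<le> N n (v a) + N n (\<lambda>j. \<Sum>s\<in>A. v s j)"
    using insert n by (intro triangle) auto
  then show ?case using insert by simp
qed (use n in \<open>simp_all add: N_zero\<close>)

text \<open>Identifies \<open>X\<close> with its tensors of length one, so that statements about the
  norm of \<open>X\<close> become the case \<open>n = 1\<close> of statements about tensors.\<close>

lemma N_1:
  assumes "1 \<le> p"
  shows "N 1 (\<lambda>i. if i = 0 then x else 0) = norm x"
proof -
  have "N 1 (\<lambda>i. (if i = 0 then 1 else 0) *\<^sub>R x) = lp_norm p 1 (\<lambda>i. if i = 0 then 1 else 0) * norm x"
    by (intro elementary) (auto simp: supported_below_def)
  moreover have "(\<lambda>i. (if i = 0 then 1 else 0) *\<^sub>R x) = (\<lambda>i::nat. if i = 0 then x else 0)" by auto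
  ultimately show ?thesis by (simp only: lp_norm_1[OF assms]) simp
qed

end

text \<open>
  A slot \<open>(n, w, s)\<close> consists of a tensor \<open>w \<in> \<ell>\<^sup>p\<^sub>n \<otimes> X\<close>, its key being \<open>(n, w)\<close>, and a vector \<open>s\<close>; an
  index \<open>i\<close> is a sequence of slots. Each key \<open>\<kappa> = (n, w)\<close> contributes one copy of \<open>(\<ell>\<^sup>p\<^sub>n)\<^sup>*\<close>, with basis
  \<open>single \<kappa> j\<close>, \<open>j < n\<close>, mapped by \<open>quot\<close> to \<open>w\<^sub>j\<close>. At index \<open>i\<close>, the \<open>k\<close>-th slot evaluates the component of
  its key at \<open>s\<close>, provided that \<open>s\<close> is in the unit ball of \<open>\<ell>\<^sup>p\<^sub>n\<close> and the key did not occur earlier.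
  For \<open>X = 0\<close> the index type of the theorem is countable and \<open>slot\<close> cannot be surjective.
\<close>

locale lattice_cover = p_multinormed p N
  for p and N :: "nat \<Rightarrow> (nat \<Rightarrow> 'a::banach) \<Rightarrow> real" +
  fixes slot :: "'i \<Rightarrow> nat \<Rightarrow> nat \<times> (nat \<Rightarrow> 'a) \<times> (nat \<Rightarrow> real)"
  assumes p_ge_1: "1 \<le> p"
    and surj_slot: "x \<noteq> (0::'a) \<Longrightarrow> surj slot"
begin

abbreviation "E \<equiv> linf_l1 (UNIV :: 'i set)"

definition key :: "'i \<Rightarrow> nat \<Rightarrow> nat \<times> (nat \<Rightarrow> 'a)" where
  "key i k = (fst (slot i k), fst (snd (slot i k)))"

definition vec :: "'i \<Rightarrow> nat \<Rightarrow> nat \<Rightarrow> real" where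
  "vec i k = snd (snd (slot i k))"

definition keys :: "(nat \<times> (nat \<Rightarrow> 'a)) set" where
  "keys = {(n, w). n \<ge> 1 \<and> w \<in> supported_below n}"

definition weight :: "nat \<times> (nat \<Rightarrow> 'a) \<Rightarrow> real" where
  "weight \<kappa> = N (fst \<kappa>) (snd \<kappa>)"

definition active :: "'i \<Rightarrow> nat \<Rightarrow> bool" where
  "active i k \<longleftrightarrow> key i k \<in> keys \<and> lp_norm p (fst (key i k)) (vec i k) \<le> 1 \<and>
    (\<forall>l<k. key i l \<noteq> key i k)"

definition eval_slots :: "(nat \<times> (nat \<Rightarrow> 'a) \<Rightarrow> nat \<Rightarrow> real) \<Rightarrow> 'i \<Rightarrow> nat \<Rightarrow> real" where
  "eval_slots f i k = (if active i k
    then weight (key i k) * (\<Sum>j<fst (key i k). f (key i k) j * vec i k j) else 0)"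

text \<open>The finite sums in the direct sum of the dual spaces. Values at positions from
  \<open>n\<close> on, at a key \<open>(n, w)\<close>, are left free; neither \<open>quot\<close>
  nor \<open>eval_slots\<close> reads them.\<close>

definition combs :: "(nat \<times> (nat \<Rightarrow> 'a) \<Rightarrow> nat \<Rightarrow> real) set" where
  "combs = {f. finite {\<kappa>. f \<kappa> \<noteq> 0} \<and> {\<kappa>. f \<kappa> \<noteq> 0} \<subseteq> keys}"

definition quot :: "(nat \<times> (nat \<Rightarrow> 'a) \<Rightarrow> nat \<Rightarrow> real) \<Rightarrow> 'a" where
  "quot f = (\<Sum>\<kappa> | f \<kappa> \<noteq> 0. \<Sum>j<fst \<kappa>. f \<kappa> j *\<^sub>R snd \<kappa> j)"

definition single :: "nat \<times> (nat \<Rightarrow> 'a) \<Rightarrow> nat \<Rightarrow> nat \<times> (nat \<Rightarrow> 'a) \<Rightarrow> nat \<Rightarrow> real" where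
  "single \<kappa> j = (\<lambda>\<kappa>' j'. if \<kappa>' = \<kappa> \<and> j' = j then 1 else 0)"

definition relations :: "(nat \<times> (nat \<Rightarrow> 'a) \<Rightarrow> nat \<Rightarrow> real) set" where
  "relations = {f \<in> combs. quot f = 0}"

text \<open>The norm closure in \<open>E\<close> of the image of the kernel of \<open>quot\<close>;
  it serves as the divisor \<open>Z\<close>.\<close>

definition relation_closure :: "('i \<Rightarrow> nat \<Rightarrow> real) set" where
  "relation_closure = {z \<in> vcarrier E. \<forall>e>0. \<exists>f\<in>relations. vnorm E (z - eval_slots f) < e}"

section \<open>Formal combinations and their images in \<open>X\<close>\<close>

lemma weight_nonneg: "\<kappa> \<in> keys \<Longrightarrow> 0 \<le> weight \<kappa>"
  by (auto simp: keys_def weight_def intro: nonneg)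

lemma subspace_combs: "subspace combs"
proof (rule subspaceI)
  fix f g assume "f \<in> combs" "g \<in> combs"
  moreover have "{\<kappa>. (f + g) \<kappa> \<noteq> 0} \<subseteq> {\<kappa>. f \<kappa> \<noteq> 0} \<union> {\<kappa>. g \<kappa> \<noteq> 0}" by auto
  ultimately show "f + g \<in> combs" unfolding combs_def using finite_subset by blast
next
  fix c f assume "f \<in> combs"
  moreover have "{\<kappa>. (c *\<^sub>R f) \<kappa> \<noteq> 0} \<subseteq> {\<kappa>. f \<kappa> \<noteq> 0}" by auto
  ultimately show "c *\<^sub>R f \<in> combs" unfolding combs_def using finite_subset by blast
qed (simp add: combs_def)

text \<open>The support changes under linear operations; summing over a common finite superset makes
  linearity of \<open>quot\<close> visible.\<close>

lemma quot_eq: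
  assumes "finite A" "{\<kappa>. f \<kappa> \<noteq> 0} \<subseteq> A"
  shows "quot f = (\<Sum>\<kappa>\<in>A. \<Sum>j<fst \<kappa>. f \<kappa> j *\<^sub>R snd \<kappa> j)"
  unfolding quot_def using assms by (intro sum.mono_neutral_left) auto

lemma quot_add:
  assumes "f \<in> combs" "g \<in> combs"
  shows "quot (f + g) = quot f + quot g"
proof -
  let ?A = "{\<kappa>. f \<kappa> \<noteq> 0} \<union> {\<kappa>. g \<kappa> \<noteq> 0}"
  have "finite ?A" using assms by (simp add: combs_def)
  then show ?thesis
    using quot_eq[of ?A f] quot_eq[of ?A g] quot_eq[of ?A "f + g"]
    by (fastforce simp: scaleR_add_left sum.distrib)
qed

lemma quot_scale:
  assumes "f \<in> combs"
  shows "quot (c *\<^sub>R f) = c *\<^sub>R quot f"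
proof -
  let ?A = "{\<kappa>. f \<kappa> \<noteq> 0}"
  have "finite ?A" using assms by (simp add: combs_def)
  then show ?thesis
    using quot_eq[of ?A f] quot_eq[of ?A "c *\<^sub>R f"] by (auto simp: scaleR_sum_right)
qed

lemma quot_diff:
  assumes "f \<in> combs" "g \<in> combs"
  shows "quot (f - g) = quot f - quot g"
  using quot_add[OF assms(1) subspace_scale[OF subspace_combs assms(2)], of "-1"] quot_scale[OF assms(2), of "-1"]
  by simp

lemma single_in_combs: "\<kappa> \<in> keys \<Longrightarrow> single \<kappa> j \<in> combs"
  unfolding combs_def single_def by (auto simp: fun_eq_iff intro: finite_subset[of _ "{\<kappa>}"])

lemma quot_single: "j < fst \<kappa> \<Longrightarrow> quot (single \<kappa> j) = snd \<kappa> j"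
  by (subst quot_eq[of "{\<kappa>}"]) (auto simp: single_def fun_eq_iff if_distrib[of "\<lambda>c. c *\<^sub>R _"] cong: if_cong)

lemma subspace_relations: "subspace relations"
proof (rule subspaceI)
  have "quot 0 = 0" by (simp add: quot_def)
  then show "0 \<in> relations" using subspace_0[OF subspace_combs] by (simp add: relations_def)
qed (auto simp: relations_def subspace_add[OF subspace_combs] subspace_scale[OF subspace_combs] quot_add quot_scale)

section \<open>Evaluation of formal combinations in the lattice\<close>

lemma eval_slots_add: "eval_slots (f + g) = eval_slots f + eval_slots g"
  by (auto simp: eval_slots_def fun_eq_iff sum.distrib algebra_simps)

lemma eval_slots_scale: "eval_slots (c *\<^sub>R f) = c *\<^sub>R eval_slots f"
  by (auto simp: eval_slots_def fun_eq_iff sum_distrib_left algebra_simps)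

lemma eval_slots_diff: "eval_slots (f - g) = eval_slots f - eval_slots g"
  using eval_slots_add[of f "(-1) *\<^sub>R g"] eval_slots_scale[of "-1" g] by simp

lemma eval_slots_zero: "eval_slots 0 = 0"
  using eval_slots_scale[of 0 0] by simp

text \<open>At a given index, a key is active in at most one slot.\<close>

lemma sum_active_slots:
  assumes S: "finite S" and b: "\<And>\<kappa>. \<kappa> \<in> S \<Longrightarrow> 0 \<le> b \<kappa>"
    and le: "\<And>k. active i k \<Longrightarrow> key i k \<in> S \<Longrightarrow> \<bar>x k\<bar> \<le> b (key i k)"
    and zero: "\<And>k. \<not> (active i k \<and> key i k \<in> S) \<Longrightarrow> x k = (0::real)"
  shows "summable (\<lambda>k. \<bar>x k\<bar>) \<and> (\<Sum>k. \<bar>x k\<bar>) \<le> (\<Sum>\<kappa>\<in>S. b \<kappa>)"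
proof -
  define T where "T = {k. active i k \<and> key i k \<in> S}"
  have inj: "inj_on (key i) T"
  proof (rule inj_onI)
    fix k l assume kl: "k \<in> T" "l \<in> T" "key i k = key i l"
    then have "\<not> k < l" "\<not> l < k" by (auto simp: T_def active_def)
    then show "k = l" by simp
  qed
  have sub: "key i ` T \<subseteq> S" by (auto simp: T_def)
  then have T: "finite T" using inj S by (meson finite_imageD finite_subset)
  have zero': "\<bar>x k\<bar> = 0" if "k \<notin> T" for k using that zero by (simp add: T_def)
  have "(\<Sum>k. \<bar>x k\<bar>) = (\<Sum>k\<in>T. \<bar>x k\<bar>)" by (rule suminf_finite[OF T zero'])
  also have "\<dots> \<le> (\<Sum>k\<in>T. b (key i k))" by (intro sum_mono le) (auto simp: T_def)
  also have "\<dots> = (\<Sum>\<kappa>\<in>key i ` T. b \<kappa>)" using inj by (simp add: sum.reindex)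
  also have "\<dots> \<le> (\<Sum>\<kappa>\<in>S. b \<kappa>)" using S sub b by (intro sum_mono2) auto
  finally show ?thesis using summable_finite[OF T zero'] by simp
qed

lemma abs_vec_le:
  assumes "active i k" "j < fst (key i k)"
  shows "\<bar>vec i k j\<bar> \<le> 1"
  using abs_le_lp_norm[OF p_ge_1 assms(2), of "vec i k"] assms(1) by (simp add: active_def)

text \<open>Vectors in active slots have coordinates of modulus at most one, and each key counts
  once, which gives a bound that does not depend on the index.\<close>

lemma eval_slots_carrier:
  assumes f: "f \<in> combs"
  shows "eval_slots f \<in> vcarrier E"
proof (rule linf_l1_carrier_bound)
  fix i :: 'i
  show "summable (\<lambda>k. \<bar>eval_slots f i k\<bar>) \<and> (\<Sum>k. \<bar>eval_slots f i k\<bar>) \<le>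
      (\<Sum>\<kappa> | f \<kappa> \<noteq> 0. weight \<kappa> * (\<Sum>j<fst \<kappa>. \<bar>f \<kappa> j\<bar>))"
  proof (rule sum_active_slots)
    show "finite {\<kappa>. f \<kappa> \<noteq> 0}" using f by (simp add: combs_def)
    show "0 \<le> weight \<kappa> * (\<Sum>j<fst \<kappa>. \<bar>f \<kappa> j\<bar>)" if "\<kappa> \<in> {\<kappa>. f \<kappa> \<noteq> 0}" for \<kappa>
      using f that by (auto simp: combs_def intro!: mult_nonneg_nonneg weight_nonneg sum_nonneg)
  next
    fix k assume k: "active i k"
    then have w: "weight (key i k) \<ge> 0" by (intro weight_nonneg) (simp add: active_def)
    have "\<bar>\<Sum>j<fst (key i k). f (key i k) j * vec i k j\<bar> \<le> (\<Sum>j<fst (key i k). \<bar>f (key i k) j * vec i k j\<bar>)"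
      by (rule sum_abs)
    also have "\<dots> \<le> (\<Sum>j<fst (key i k). \<bar>f (key i k) j\<bar>)"
      using abs_vec_le[OF k] by (intro sum_mono) (auto simp: abs_mult intro!: mult_left_le)
    finally show "\<bar>eval_slots f i k\<bar> \<le> weight (key i k) * (\<Sum>j<fst (key i k). \<bar>f (key i k) j\<bar>)"
      using k w by (simp add: eval_slots_def abs_mult mult_left_mono)
  next
    fix k assume "\<not> (active i k \<and> key i k \<in> {\<kappa>. f \<kappa> \<noteq> 0})"
    then show "eval_slots f i k = 0" by (auto simp: eval_slots_def)
  qed
qed simp

text \<open>The basis of the copy at \<open>(n, w)\<close>, read as a tensor, is the identity
  operator of the l^p space. At each index it contributes in at most one slot, with value
  \<open>N n w\<close> times the norm of a point of the unit ball.\<close>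

lemma eval_slots_tensor_upper:
  assumes \<kappa>: "(n, w) \<in> keys"
  shows "vnorm E (\<lambda>i k. lp_norm p n (\<lambda>j. eval_slots (single (n, w) j) i k)) \<le> N n w"
proof (rule linf_l1_norm_le)
  fix i :: 'i
  have n: "n \<ge> 1" using \<kappa> by (simp add: keys_def)
  have val: "lp_norm p n (\<lambda>j. eval_slots (single (n, w) j) i k) =
      (if active i k \<and> key i k = (n, w) then N n w * lp_norm p n (vec i k) else 0)" for k
  proof (cases "active i k \<and> key i k = (n, w)")
    case True
    have "eval_slots (single (n, w) j) i k = N n w * vec i k j" if "j < n" for j
    proof -
      have "(\<Sum>l<n. single (n, w) j (n, w) l * vec i k l) = (\<Sum>l<n. if l = j then vec i k j else 0)"
        by (intro sum.cong) (auto simp: single_def)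
      then show ?thesis using True that by (simp add: eval_slots_def weight_def)
    qed
    then have "lp_norm p n (\<lambda>j. eval_slots (single (n, w) j) i k) = lp_norm p n (\<lambda>j. N n w * vec i k j)"
      by (intro lp_norm_cong)
    then show ?thesis using True weight_nonneg[OF \<kappa>] n p_ge_1 by (simp add: lp_norm_scale weight_def)
  next
    case False
    then have "(\<lambda>j. eval_slots (single (n, w) j) i k) = (\<lambda>_. 0)"
      by (auto simp: eval_slots_def single_def fun_eq_iff)
    then show ?thesis using False n by (auto simp: lp_norm_zero)
  qed
  have "(\<Sum>k. \<bar>lp_norm p n (\<lambda>j. eval_slots (single (n, w) j) i k)\<bar>) \<le> (\<Sum>\<kappa>\<in>{(n, w)}. weight \<kappa>)"
  proof (rule sum_active_slots[THEN conjunct2])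
    fix k assume k: "active i k" "key i k \<in> {(n, w)}"
    then have "lp_norm p n (vec i k) \<le> 1" by (simp add: active_def)
    then show "\<bar>lp_norm p n (\<lambda>j. eval_slots (single (n, w) j) i k)\<bar> \<le> weight (key i k)"
      using k weight_nonneg[OF \<kappa>] lp_norm_nonneg[OF n, of p "vec i k"]
      by (simp add: val weight_def abs_mult mult_left_le)
  qed (use weight_nonneg \<kappa> in \<open>auto simp: val\<close>)
  then show "(\<Sum>k. \<bar>lp_norm p n (\<lambda>j. eval_slots (single (n, w) j) i k)\<bar>) \<le> N n w"
    by (simp add: weight_def)
qed (use weight_nonneg[OF \<kappa>] in \<open>simp add: weight_def\<close>)

text \<open>
  The component of \<open>(h\<^sub>j)\<close> at the key \<open>(n, w)\<close> is an operator from \<open>\<ell>\<^sup>p\<^sub>n\<close> to \<open>\<ell>\<^sup>p\<^sub>m\<close>. Some index has all keys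
  that occur in \<open>(h\<^sub>j)\<close> in its slots, each with a vector at which the operator almost attains its norm.
\<close>

lemma eval_slots_tensor_lower:
  assumes m: "m \<ge> 1" and h: "\<And>j. j < m \<Longrightarrow> h j \<in> combs"
  shows "N m (\<lambda>j. if j < m then quot (h j) else 0) \<le>
    vnorm E (\<lambda>i k. lp_norm p m (\<lambda>j. eval_slots (h j) i k))"
proof -
  define y where "y = (\<lambda>i k. lp_norm p m (\<lambda>j. eval_slots (h j) i k))"
  have y: "y \<in> vcarrier E" unfolding y_def
    by (rule linf_l1_pointwise_carrier[OF lp_norm_in_krivine_functions[OF p_ge_1 m]])
      (auto intro: eval_slots_carrier h)
  show ?thesis
  proof (cases "\<exists>x::'a. x \<noteq> 0")
    \<comment> \<open>For \<open>X = 0\<close> the left side is zero, and no suitable index needs to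
      be found.\<close>
    case False
    then have "(\<lambda>j. if j < m then quot (h j) else 0) = (\<lambda>_. 0)" by auto
    then show ?thesis using linf_l1_norm_nonneg[OF y] m by (simp add: N_zero y_def)
  next
    case True
    then have surj: "surj slot" using surj_slot by blast
    define A where "A = (\<Union>j<m. {\<kappa>. h j \<kappa> \<noteq> 0})"
    have A: "finite A" "A \<subseteq> keys" using h by (auto simp: A_def combs_def)
    define T where "T \<kappa> = (\<lambda>j l. h j \<kappa> l)" for \<kappa>
    define op where "op \<kappa> = lp_opnorm p (fst \<kappa>) m (T \<kappa>)" for \<kappa>
    have upper: "N m (\<lambda>j. if j < m then quot (h j) else 0) \<le> (\<Sum>\<kappa>\<in>A. op \<kappa> * weight \<kappa>)"
    proof -
      have "quot (h j) = (\<Sum>\<kappa>\<in>A. \<Sum>l<fst \<kappa>. h j \<kappa> l *\<^sub>R snd \<kappa> l)" if "j < m" for j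
        using that A by (intro quot_eq) (auto simp: A_def)
      \<comment> \<open>The tensor of images is a sum over the keys \<open>\<kappa>\<close> of
        \<open>T \<kappa>\<close>, tensored with the identity, applied to the tensor in
        \<open>\<kappa>\<close>; this makes \<open>operator_bound\<close> applicable.\<close>
      then have eq: "(\<lambda>j. if j < m then quot (h j) else 0) =
          (\<lambda>j. \<Sum>\<kappa>\<in>A. mat_apply (fst \<kappa>) m (T \<kappa>) (snd \<kappa>) j)"
        by (auto simp: mat_apply_def T_def fun_eq_iff)
      have "N m (\<lambda>j. if j < m then quot (h j) else 0) \<le> (\<Sum>\<kappa>\<in>A. N m (mat_apply (fst \<kappa>) m (T \<kappa>) (snd \<kappa>)))"
        unfolding eq using m by (intro N_sum) (auto simp: mat_apply_def supported_below_def)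
      also have "\<dots> \<le> (\<Sum>\<kappa>\<in>A. op \<kappa> * weight \<kappa>)"
        using A m unfolding op_def weight_def by (intro sum_mono operator_bound) (auto simp: keys_def)
      finally show ?thesis .
    qed
    have lower: "(\<Sum>\<kappa>\<in>A. op \<kappa> * weight \<kappa>) \<le> vnorm E y + e * (\<Sum>\<kappa>\<in>A. weight \<kappa>)" if e: "e > 0" for e
    proof -
      have "\<exists>s. lp_norm p (fst \<kappa>) s \<le> 1 \<and> op \<kappa> - e < lp_norm p m (mat_apply (fst \<kappa>) m (T \<kappa>) s)"
        if "\<kappa> \<in> A" for \<kappa>
      proof -
        have "fst \<kappa> \<ge> 1" using that A by (auto simp: keys_def)
        then have "(\<lambda>_. 0) \<in> {a \<in> supported_below (fst \<kappa>). lp_norm p (fst \<kappa>) a \<le> 1}"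
          by (simp add: supported_below_def lp_norm_zero)
        then have "\<exists>r \<in> (\<lambda>a. lp_norm p m (mat_apply (fst \<kappa>) m (T \<kappa>) a)) `
            {a \<in> supported_below (fst \<kappa>). lp_norm p (fst \<kappa>) a \<le> 1}. op \<kappa> - e < r"
          using e by (intro less_cSupD) (auto simp: op_def lp_opnorm_def)
        then show ?thesis by blast
      qed
      then obtain s where s: "\<And>\<kappa>. \<kappa> \<in> A \<Longrightarrow> lp_norm p (fst \<kappa>) (s \<kappa>) \<le> 1"
          "\<And>\<kappa>. \<kappa> \<in> A \<Longrightarrow> op \<kappa> - e < lp_norm p m (mat_apply (fst \<kappa>) m (T \<kappa>) (s \<kappa>))"
        by metis
      obtain xs where xs: "set xs = A" "distinct xs" using A finite_distinct_list by blast
      \<comment> \<open>The slot sequence of the wanted index. The padding has length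
        \<open>0\<close> and so is not in \<open>keys\<close>, which makes those slots
        inactive.\<close>
      define \<sigma> where "\<sigma> = (\<lambda>k. if k < length xs then (fst (xs ! k), snd (xs ! k), s (xs ! k))
          else (0, (\<lambda>_. 0), (\<lambda>_. 0)))"
      obtain i where "\<sigma> = slot i" using surjD[OF surj, of \<sigma>] by blast
      then have i: "slot i = \<sigma>" by simp
      have key: "key i k = xs ! k" and vec: "vec i k = s (xs ! k)" if "k < length xs" for k
        using that by (simp_all add: key_def vec_def i \<sigma>_def)
      have act: "active i k" if k: "k < length xs" for k
      proof -
        have "xs ! l \<noteq> xs ! k" if "l < k" for l
          using that k xs(2) by (simp add: nth_eq_iff_index_eq)
        moreover have "xs ! k \<in> A" using k xs(1) by auto
        ultimately show ?thesis using k A s(1) by (auto simp: active_def key vec)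
      qed
      have y_val: "y i k = weight (xs ! k) * lp_norm p m (mat_apply (fst (xs ! k)) m (T (xs ! k)) (s (xs ! k)))"
        if k: "k < length xs" for k
      proof -
        have "xs ! k \<in> keys" using k xs(1) A by auto
        then have w: "weight (xs ! k) \<ge> 0" by (rule weight_nonneg)
        have "y i k = lp_norm p m (\<lambda>j. weight (xs ! k) * mat_apply (fst (xs ! k)) m (T (xs ! k)) (s (xs ! k)) j)"
          unfolding y_def using k by (intro lp_norm_cong) (simp add: eval_slots_def act key vec mat_apply_def T_def)
        then show ?thesis using w m p_ge_1 by (simp add: lp_norm_scale)
      qed
      have "(\<Sum>\<kappa>\<in>A. op \<kappa> * weight \<kappa>) - e * (\<Sum>\<kappa>\<in>A. weight \<kappa>) = (\<Sum>\<kappa>\<in>A. weight \<kappa> * (op \<kappa> - e))"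
        by (simp add: sum_distrib_left algebra_simps sum_subtractf)
      also have "\<dots> \<le> (\<Sum>\<kappa>\<in>A. weight \<kappa> * lp_norm p m (mat_apply (fst \<kappa>) m (T \<kappa>) (s \<kappa>)))"
        using s(2) A weight_nonneg by (intro sum_mono mult_left_mono) (auto intro: less_imp_le)
      also have "\<dots> = (\<Sum>k<length xs. y i k)"
        using sum.reindex_bij_betw[OF bij_betw_nth[OF xs(2) refl xs(1)[symmetric]], symmetric]
        by (simp add: y_val)
      also have "\<dots> \<le> (\<Sum>k<length xs. \<bar>y i k\<bar>)" by (intro sum_mono) auto
      also have "\<dots> \<le> (\<Sum>k. \<bar>y i k\<bar>)" by (intro sum_le_suminf linf_l1_summable[OF y]) auto
      also have "\<dots> \<le> vnorm E y" by (intro linf_l1_norm_ge y) simp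
      finally show ?thesis by simp
    qed
    have "N m (\<lambda>j. if j < m then quot (h j) else 0) \<le> vnorm E y + e" if e: "e > 0" for e
    proof -
      \<comment> \<open>The error is rescaled by \<open>1 + B\<close> rather than \<open>B\<close>,
        since the total weight may be zero.\<close>
      define B where "B = (\<Sum>\<kappa>\<in>A. weight \<kappa>)"
      have B: "B \<ge> 0" unfolding B_def using A weight_nonneg by (intro sum_nonneg) auto
      have "N m (\<lambda>j. if j < m then quot (h j) else 0) \<le> vnorm E y + e / (1 + B) * B"
        using upper lower[of "e / (1 + B)"] e B by (simp add: B_def)
      moreover have "e / (1 + B) * B \<le> e" using e B by (simp add: field_simps)
      ultimately show ?thesis by linarith
    qed
    then show ?thesis unfolding y_def by (rule field_le_epsilon)
  qed
qed

section \<open>The closed subspace of relations\<close>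

lemma eval_slots_relation: "f \<in> relations \<Longrightarrow> eval_slots f \<in> relation_closure"
  using eval_slots_carrier linf_l1_norm_zero[where 'a='i]
  by (auto simp: relation_closure_def relations_def intro!: bexI[of _ f])

text \<open>The approximating relations add and scale along with the elements they approximate; for
  limits, a relation near a late member of the sequence is also near the limit.\<close>

lemma closed_subspace_relation_closure:
  "closed_subspace (natural_multinorm p E) relation_closure"
  unfolding closed_subspace_def natural_multinorm_simps linf_l1_simps
proof (intro conjI ballI allI impI)
  note sub = linf_l1_carrier_subspace[where 'a='i and I=UNIV]
  have rel_carrier: "eval_slots f \<in> vcarrier E" if "f \<in> relations" for f
    using that by (auto simp: relations_def intro: eval_slots_carrier)
  show "relation_closure \<subseteq> vcarrier E" by (auto simp: relation_closure_def)
  show "0 \<in> relation_closure"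
    using eval_slots_relation[OF subspace_0[OF subspace_relations]] by (simp add: eval_slots_zero)
  {
    fix x y assume x: "x \<in> relation_closure" and y: "y \<in> relation_closure"
    have "\<exists>f\<in>relations. vnorm E (x + y - eval_slots f) < e" if "e > 0" for e
    proof -
      have "e / 2 > 0" using that by simp
      then obtain f g where f: "f \<in> relations" "vnorm E (x - eval_slots f) < e / 2"
        and g: "g \<in> relations" "vnorm E (y - eval_slots g) < e / 2"
        using x y unfolding relation_closure_def by blast
      have "vnorm E ((x - eval_slots f) + (y - eval_slots g)) \<le> vnorm E (x - eval_slots f) + vnorm E (y - eval_slots g)"
        using x y f g by (intro linf_l1_norm_triangle subspace_diff[OF sub] rel_carrier) (auto simp: relation_closure_def)
      also have "\<dots> < e" using f g by simp
      also have "(x - eval_slots f) + (y - eval_slots g) = x + y - eval_slots (f + g)"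
        by (simp add: eval_slots_add)
      finally show ?thesis using subspace_add[OF subspace_relations f(1) g(1)] by blast
    qed
    then show "x + y \<in> relation_closure"
      using x y subspace_add[OF sub] by (simp add: relation_closure_def)
  }
  {
    fix c x assume x: "x \<in> relation_closure"
    have "\<exists>f\<in>relations. vnorm E (c *\<^sub>R x - eval_slots f) < e" if "e > 0" for e
    proof -
      have "e / (\<bar>c\<bar> + 1) > 0" using that by (simp add: add_nonneg_pos)
      then obtain f where f: "f \<in> relations" "vnorm E (x - eval_slots f) < e / (\<bar>c\<bar> + 1)"
        using x unfolding relation_closure_def by blast
      have xf: "x - eval_slots f \<in> vcarrier E"
        using x f by (intro subspace_diff[OF sub] rel_carrier) (auto simp: relation_closure_def)
      have "vnorm E (c *\<^sub>R x - eval_slots (c *\<^sub>R f)) = vnorm E (c *\<^sub>R (x - eval_slots f))"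
        by (simp add: eval_slots_scale scaleR_diff_right)
      also have "\<dots> \<le> \<bar>c\<bar> * vnorm E (x - eval_slots f)" by (rule linf_l1_norm_scale[OF xf])
      also have "\<dots> \<le> (\<bar>c\<bar> + 1) * vnorm E (x - eval_slots f)"
        using linf_l1_norm_nonneg[OF xf] by (simp add: distrib_right)
      also have "\<dots> < e" using f(2) by (simp add: pos_less_divide_eq mult.commute)
      finally show ?thesis using subspace_scale[OF subspace_relations f(1)] by blast
    qed
    then show "c *\<^sub>R x \<in> relation_closure"
      using x subspace_scale[OF sub] by (simp add: relation_closure_def)
  }
  {
    fix s x assume x: "x \<in> vcarrier E"
      and "(\<forall>k. s k \<in> relation_closure) \<and> (\<lambda>k. vnorm E (s k + (- 1) *\<^sub>R x)) \<longlonglongrightarrow> 0"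
    then have s: "\<And>k. s k \<in> relation_closure" and lim: "(\<lambda>k. vnorm E (s k - x)) \<longlonglongrightarrow> 0" by simp_all
    have "\<exists>f\<in>relations. vnorm E (x - eval_slots f) < e" if "e > 0" for e
    proof -
      have e: "e / 2 > 0" using that by simp
      have "\<forall>\<^sub>F k in sequentially. vnorm E (s k - x) < e / 2" using lim e by (rule order_tendstoD)
      then obtain k where k: "vnorm E (s k - x) < e / 2" by (auto simp: eventually_sequentially)
      obtain f where f: "f \<in> relations" "vnorm E (s k - eval_slots f) < e / 2"
        using s e unfolding relation_closure_def by blast
      have sx: "s k - x \<in> vcarrier E" "s k - eval_slots f \<in> vcarrier E"
        using s x f by (auto intro!: subspace_diff[OF sub] rel_carrier simp: relation_closure_def)
      have "vnorm E (- (s k - x) + (s k - eval_slots f)) \<le> vnorm E (- (s k - x)) + vnorm E (s k - eval_slots f)"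
        by (intro linf_l1_norm_triangle subspace_neg[OF sub] sx)
      also have "\<dots> < e" using linf_l1_norm_uminus[OF sx(1)] k f by simp
      also have "- (s k - x) + (s k - eval_slots f) = x - eval_slots f" by simp
      finally show ?thesis using f by blast
    qed
    then show "x \<in> relation_closure" using x by (simp add: relation_closure_def)
  }
qed

text \<open>The key of \<open>x\<close> viewed as a tensor of length one. Its single basis vector is
  a preimage of \<open>x\<close> under \<open>quot\<close>, from which \<open>lift\<close> is
  formed; this choice is linear only up to relations.\<close>

definition point_key :: "'a \<Rightarrow> nat \<times> (nat \<Rightarrow> 'a)" where
  "point_key x = (1, \<lambda>i. if i = 0 then x else 0)"

definition lift :: "'a \<Rightarrow> 'i \<Rightarrow> nat \<Rightarrow> real" where
  "lift x = eval_slots (single (point_key x) 0)"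

lemma point_comb: "single (point_key x) 0 \<in> combs"
  by (rule single_in_combs) (auto simp: point_key_def keys_def supported_below_def)

lemma quot_point: "quot (single (point_key x) 0) = x"
  by (subst quot_single) (auto simp: point_key_def)

text \<open>Two combinations with the same image differ by a relation, so any preimage of
  \<open>x\<close> represents the same class as \<open>lift x\<close>.\<close>

lemma eval_slots_diff_lift:
  assumes "f \<in> combs" "quot f = x"
  shows "eval_slots f - lift x \<in> relation_closure"
  unfolding lift_def eval_slots_diff[symmetric] using assms
  by (intro eval_slots_relation)
    (simp add: relations_def quot_diff quot_point point_comb subspace_diff[OF subspace_combs])

text \<open>Up to an error \<open>e / n\<close>, each \<open>t j\<close> is the evaluation of a
  combination with image \<open>w j\<close>. For such evaluations the bound is
  \<open>eval_slots_tensor_lower\<close>, and the \<open>n\<close> errors enter the lattice norm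
  additively.\<close>

lemma lift_tensor_lower:
  assumes n: "n \<ge> 1" and w: "w \<in> supported_below n"
    and t: "\<And>i. i < n \<Longrightarrow> t i \<in> vcarrier E" "\<And>i. i < n \<Longrightarrow> t i - lift (w i) \<in> relation_closure"
  shows "N n w \<le> vnorm E (\<lambda>i k. lp_norm p n (\<lambda>j. t j i k))"
proof (rule field_le_epsilon)
  note sub = linf_l1_carrier_subspace[where 'a='i and I=UNIV]
  fix e :: real assume "e > 0"
  then have e: "e / n > 0" using n by simp
  have "\<exists>f. f \<in> relations \<and> vnorm E (t j - lift (w j) - eval_slots f) < e / n" if "j < n" for j
    using t(2)[OF that] e unfolding relation_closure_def by blast
  then obtain f where f: "\<And>j. j < n \<Longrightarrow> f j \<in> relations"
      "\<And>j. j < n \<Longrightarrow> vnorm E (t j - lift (w j) - eval_slots (f j)) < e / n"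
    by metis
  \<comment> \<open>Adding the relation to the chosen preimage of \<open>w j\<close> keeps the image
    and brings the evaluation close to \<open>t j\<close>.\<close>
  define h where "h j = single (point_key (w j)) 0 + f j" for j
  have h: "h j \<in> combs" "quot (h j) = w j" if "j < n" for j
    using f(1)[OF that] by (auto simp: h_def relations_def quot_add quot_point point_comb subspace_add[OF subspace_combs])
  have h_close: "vnorm E (t j - eval_slots (h j)) < e / n" if "j < n" for j
    using f(2)[OF that] by (simp add: h_def eval_slots_add lift_def diff_diff_eq)
  define y where "y = (\<lambda>i k. lp_norm p n (\<lambda>j. t j i k))"
  define r where "r j = (\<lambda>i k. \<bar>(t j - eval_slots (h j)) i k\<bar>)" for j
  have y: "y \<in> vcarrier E" unfolding y_def
    by (rule linf_l1_pointwise_carrier[OF lp_norm_in_krivine_functions[OF p_ge_1 n]]) (rule t)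
  have r: "r j \<in> vcarrier E" "vnorm E (r j) \<le> e / n" if "j < n" for j
  proof -
    have d: "t j - eval_slots (h j) \<in> vcarrier E"
      using that by (intro subspace_diff[OF sub] t eval_slots_carrier h)
    show "r j \<in> vcarrier E" unfolding r_def by (rule linf_l1_abs[OF d])
    have "vnorm E (r j) \<le> vnorm E (t j - eval_slots (h j))"
      unfolding r_def by (rule linf_l1_dominated(2)[OF d]) simp
    then show "vnorm E (r j) \<le> e / n" using h_close[OF that] by simp
  qed
  have yr: "(\<Sum>j<n. r j) \<in> vcarrier E" using r by (intro subspace_sum[OF sub]) auto
  have "w = (\<lambda>j. if j < n then quot (h j) else 0)"
    using w h(2) by (auto simp: supported_below_def fun_eq_iff)
  then have "N n w \<le> vnorm E (\<lambda>i k. lp_norm p n (\<lambda>j. eval_slots (h j) i k))"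
    using eval_slots_tensor_lower[OF n h(1)] by simp
  also have "\<dots> \<le> vnorm E (y + (\<Sum>j<n. r j))"
  proof (rule linf_l1_dominated(2)[OF subspace_add[OF sub y yr]])
    fix i k
    have "lp_norm p n (\<lambda>j. eval_slots (h j) i k) \<le> (y + (\<Sum>j<n. r j)) i k"
      using lp_norm_le_add_sum[OF p_ge_1 n, of "\<lambda>j. eval_slots (h j) i k" "\<lambda>j. t j i k"]
      by (simp add: y_def r_def abs_minus_commute)
    then show "\<bar>lp_norm p n (\<lambda>j. eval_slots (h j) i k)\<bar> \<le> \<bar>(y + (\<Sum>j<n. r j)) i k\<bar>"
      using lp_norm_nonneg[OF n] by (metis abs_ge_self abs_of_nonneg order_trans)
  qed
  also have "\<dots> \<le> vnorm E y + vnorm E (\<Sum>j<n. r j)" by (rule linf_l1_norm_triangle[OF y yr])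
  also have "vnorm E (\<Sum>j<n. r j) \<le> (\<Sum>j<n. vnorm E (r j))" using r by (intro linf_l1_norm_sum) auto
  also have "\<dots> \<le> (\<Sum>j<n. e / n)" using r by (intro sum_mono) auto
  also have "\<dots> = e" using n by simp
  finally show "N n w \<le> vnorm E (\<lambda>i k. lp_norm p n (\<lambda>j. t j i k)) + e" by (simp add: y_def)
qed

text \<open>The tensor \<open>w\<close> is itself a key, and the basis vectors of its copy are
  preimages of its entries that do not increase the norm.\<close>

lemma lift_tensor_upper:
  assumes n: "n \<ge> 1" and w: "w \<in> supported_below n"
  obtains t where "\<And>i. i < n \<Longrightarrow> t i \<in> vcarrier E" "\<And>i. i \<ge> n \<Longrightarrow> t i = 0"
    "\<And>i. i < n \<Longrightarrow> t i - lift (w i) \<in> relation_closure"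
    "vnorm E (\<lambda>i k. lp_norm p n (\<lambda>j. t j i k)) \<le> N n w"
proof
  let ?t = "\<lambda>j. if j < n then eval_slots (single (n, w) j) else 0"
  have \<kappa>: "(n, w) \<in> keys" using n w by (simp add: keys_def)
  show "?t i \<in> vcarrier E" if "i < n" for i
    using that \<kappa> by (simp add: eval_slots_carrier single_in_combs)
  show "?t i - lift (w i) \<in> relation_closure" if "i < n" for i
    using that \<kappa> quot_single[of i "(n, w)"] by (simp add: eval_slots_diff_lift single_in_combs)
  have "(\<lambda>i k. lp_norm p n (\<lambda>j. ?t j i k)) = (\<lambda>i k. lp_norm p n (\<lambda>j. eval_slots (single (n, w) j) i k))"
    by (intro ext lp_norm_cong) simp
  then show "vnorm E (\<lambda>i k. lp_norm p n (\<lambda>j. ?t j i k)) \<le> N n w"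
    using eval_slots_tensor_upper[OF \<kappa>] by simp
qed simp

text \<open>The two conditions on the norm of \<open>X\<close> are the tensor conditions for
  \<open>n = 1\<close>, where the l^p norm is the absolute value.\<close>

sublocale lift_to_quotient "natural_multinorm p E" relation_closure N lift
proof
  note sub = linf_l1_carrier_subspace[where 'a='i and I=UNIV]
  show "closed_subspace (natural_multinorm p E) relation_closure" by (rule closed_subspace_relation_closure)
  show "lift x \<in> vcarrier (natural_multinorm p E)" for x
    by (simp add: lift_def eval_slots_carrier point_comb)
  show "lift (x + y) - (lift x + lift y) \<in> relation_closure" for x y
  proof -
    have "lift (x + y) - (lift x + lift y) =
        eval_slots (single (point_key (x + y)) 0 - (single (point_key x) 0 + single (point_key y) 0))"
      by (simp add: lift_def eval_slots_diff eval_slots_add)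
    then show ?thesis
      using point_comb by (simp add: eval_slots_relation relations_def quot_diff quot_add quot_point
          subspace_add[OF subspace_combs] subspace_diff[OF subspace_combs])
  qed
  show "lift (c *\<^sub>R x) - c *\<^sub>R lift x \<in> relation_closure" for c x
  proof -
    have "lift (c *\<^sub>R x) - c *\<^sub>R lift x =
        eval_slots (single (point_key (c *\<^sub>R x)) 0 - c *\<^sub>R single (point_key x) 0)"
      by (simp add: lift_def eval_slots_diff eval_slots_scale)
    then show ?thesis
      using point_comb by (simp add: eval_slots_relation relations_def quot_diff quot_scale quot_point
          subspace_scale[OF subspace_combs] subspace_diff[OF subspace_combs])
  qed
  show "norm x \<le> vnorm (natural_multinorm p E) v"
    if v: "v \<in> vcarrier (natural_multinorm p E)" and vx: "v - lift x \<in> relation_closure" for v x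
  proof -
    have "norm x = N 1 (\<lambda>i. if i = 0 then x else 0)" using N_1[OF p_ge_1] by simp
    also have "\<dots> \<le> vnorm E (\<lambda>i k. lp_norm p 1 (\<lambda>j. v i k))"
      using v vx by (intro lift_tensor_lower) (auto simp: supported_below_def)
    also have "\<dots> \<le> vnorm E v"
      using v by (intro linf_l1_dominated(2)) (simp_all add: lp_norm_1[OF p_ge_1, simplified])
    finally show ?thesis by simp
  qed
  show "\<exists>v\<in>vcarrier (natural_multinorm p E). v - lift x \<in> relation_closure \<and>
      vnorm (natural_multinorm p E) v \<le> norm x" for x
  proof -
    obtain t where t: "t 0 \<in> vcarrier E" "t 0 - lift x \<in> relation_closure"
        "vnorm E (\<lambda>i k. lp_norm p 1 (\<lambda>j. t j i k)) \<le> norm x"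
    proof (rule lift_tensor_upper[of 1 "\<lambda>i. if i = 0 then x else 0"])
      fix t assume "\<And>i. i < 1 \<Longrightarrow> t i \<in> vcarrier E"
        "\<And>i. i < 1 \<Longrightarrow> t i - lift (if i = 0 then x else 0) \<in> relation_closure"
        "vnorm E (\<lambda>i k. lp_norm p 1 (\<lambda>j. t j i k)) \<le> N 1 (\<lambda>i. if i = 0 then x else 0)"
      then show thesis using that[of t] N_1[OF p_ge_1, of x] by simp
    qed (auto simp: supported_below_def)
    have "vnorm E (t 0) \<le> vnorm E (\<lambda>i k. \<bar>t 0 i k\<bar>)"
      by (rule linf_l1_dominated(2)[OF linf_l1_abs[OF t(1)]]) simp
    then show ?thesis using t by (auto simp: lp_norm_1[OF p_ge_1, simplified])
  qed
  show "N n w \<le> mnorm (natural_multinorm p E) n t"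
    if "n \<ge> 1" "w \<in> supported_below n" "t \<in> tensors n (natural_multinorm p E)"
      "\<And>i. i < n \<Longrightarrow> t i - lift (w i) \<in> relation_closure" for n w t
  proof -
    have "t i \<in> vcarrier E" if "i < n" for i using that \<open>t \<in> _\<close> by (simp add: tensors_def)
    then show ?thesis using that lift_tensor_lower[of n w t] by (simp add: mnorm_natural_linf_l1 p_ge_1)
  qed
  show "\<exists>v\<in>tensors n (natural_multinorm p E). (\<forall>i<n. v i - lift (w i) \<in> relation_closure) \<and>
      mnorm (natural_multinorm p E) n v \<le> N n w"
    if nw: "n \<ge> 1" "w \<in> supported_below n" for n w
  proof -
    obtain t where t: "\<And>i. i < n \<Longrightarrow> t i \<in> vcarrier E" "\<And>i. i \<ge> n \<Longrightarrow> t i = 0"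
      "\<And>i. i < n \<Longrightarrow> t i - lift (w i) \<in> relation_closure"
      "vnorm E (\<lambda>i k. lp_norm p n (\<lambda>j. t j i k)) \<le> N n w"
      using lift_tensor_upper[OF nw] by blast
    then show ?thesis using nw by (auto simp: mnorm_natural_linf_l1 p_ge_1 tensors_def intro!: bexI[of _ t])
  qed
qed (simp_all add: linf_l1_carrier_subspace linf_l1_norm_zero linf_l1_norm_nonneg linf_l1_norm_triangle
    linf_l1_norm_uminus)

end

text \<open>A whole sequence of slots is coded injectively by one sequence in \<open>X\<close>,
  numbers being stored as multiples of \<open>x\<close>; an inverse of the coding is the surjection.
  Thus indices can be taken from the type of keys.\<close>

lemma ex_surj_slots:
  fixes x :: "'a::real_vector"
  assumes x: "x \<noteq> 0"
  shows "\<exists>slot :: nat \<times> (nat \<Rightarrow> 'a) \<Rightarrow> nat \<Rightarrow> nat \<times> (nat \<Rightarrow> 'a) \<times> (nat \<Rightarrow> real). surj slot"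
proof -
  \<comment> \<open>Position \<open>m\<close> decodes to a slot \<open>k\<close>, a selector
    \<open>c\<close> for the component of that slot, and a coordinate \<open>j\<close>.\<close>
  define enc :: "(nat \<Rightarrow> nat \<times> (nat \<Rightarrow> 'a) \<times> (nat \<Rightarrow> real)) \<Rightarrow> nat \<times> (nat \<Rightarrow> 'a)" where
    "enc \<sigma> = (0, \<lambda>m. case prod_decode m of (k, l) \<Rightarrow> (case prod_decode l of (c, j) \<Rightarrow>
      if c = 0 then real (fst (\<sigma> k)) *\<^sub>R x else if c = 1 then fst (snd (\<sigma> k)) j else snd (snd (\<sigma> k)) j *\<^sub>R x))" for \<sigma>
  have "inj enc"
  proof (rule injI)
    fix \<sigma> \<tau> assume "enc \<sigma> = enc \<tau>"
    then have eq: "snd (enc \<sigma>) (prod_encode (k, prod_encode (c, j))) = snd (enc \<tau>) (prod_encode (k, prod_encode (c, j)))"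
      for k c j by simp
    show "\<sigma> = \<tau>"
    proof
      fix k
      have "fst (\<sigma> k) = fst (\<tau> k)" using eq[of k 0 0] x by (simp add: enc_def)
      moreover have "fst (snd (\<sigma> k)) = fst (snd (\<tau> k))" using eq[of k 1] by (simp add: enc_def fun_eq_iff)
      moreover have "snd (snd (\<sigma> k)) = snd (snd (\<tau> k))" using eq[of k 2] x by (simp add: enc_def fun_eq_iff)
      ultimately show "\<sigma> k = \<tau> k" by (simp add: prod_eq_iff)
    qed
  qed
  then show ?thesis using inj_imp_surj_inv by blast
qed

theorem theorem3p11:
  fixes p :: ennreal
    and N :: "nat \<Rightarrow> (nat \<Rightarrow> 'a::banach) \<Rightarrow> real"
  assumes "1 \<le> p"
    and "p_multinormed p N"
  shows "\<exists>(I :: (nat \<times> (nat \<Rightarrow> 'a)) set) Z Y.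
    closed_subspace (natural_multinorm p (linf_l1 I)) Z \<and>
    closed_subspace (quotient_by (natural_multinorm p (linf_l1 I)) Z) Y \<and>
    multiisometric (multinormed_space N)
      (subspace_of (quotient_by (natural_multinorm p (linf_l1 I)) Z) Y)"
proof -
  obtain slot :: "nat \<times> (nat \<Rightarrow> 'a) \<Rightarrow> nat \<Rightarrow> nat \<times> (nat \<Rightarrow> 'a) \<times> (nat \<Rightarrow> real)"
    where slot: "(\<exists>x::'a. x \<noteq> 0) \<longrightarrow> surj slot"
    using ex_surj_slots by blast
  interpret p_multinormed p N by fact
  interpret lattice_cover p N slot
    by unfold_locales (use assms slot in auto)
  \<comment> \<open>\<open>I\<close> is the whole index type, \<open>Z\<close> the closure of the
    relations and \<open>Y\<close> the range of \<open>embed\<close>.\<close>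
  show ?thesis
    using closed_subspace_relation_closure closed_subspace_range_embed multiisometric_range_embed by blast
qed

end
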